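(* There is an infinite ascending chain $\mathbf M_1 \le \mathbf M_2 \le \mathbf M_3 \le \cdots$ of finite automatic algebras (each $\mathbf M_n$ a subalgebra of $\mathbf M_{n+1}$) that are alternately dualizable and non-dualizable, i.e. for every $n\ge 1$ exactly one of $\mathbf M_n$, $\mathbf M_{n+1}$ is dualizable.
   Context: **Automatic algebras.** An automatic algebra is an algebra with a single binary operation $\mathbf M = \langle Q \cup \Sigma \cup \{0\}; \cdot\rangle$, where $Q$ (states) and $\Sigma$ (letters) are disjoint sets and $0 \notin Q\cup\Sigma$, that encodes a partial (deterministic) automaton: each letter $a \in \Sigma$ acts as a partial map $Q \to Q$; for $q,r\in Q$ and $a \in \Sigma$ we have $q\cdot a = r$ iff $a$ sends $q$ to $r$; all other products are $0$. **Dualizability.** Let $\mathbf M$ be a finite algebra with universe $M$. A $k$-ary relation on $M$ ($k\ge 1$) is compatible with $\mathbf M$ if it is a subuniverse of $\mathbf M^k$. For $\mathbf A \in \mathbb{ISP}(\mathbf M)$ (isomorphic copies of subalgebras of powers of $\mathbf M$), view $\hom(\mathbf A,\mathbf M)\subseteq M^A$ with the subspace topology of the product topology ($M$ discrete), and with relations on $M$ interpreted pointwise. A map $f\colon \hom(\mathbf A,\mathbf M)\to M$ is an evaluation if there is $a\in A$ with $f(x)=x(a)$ for all $x$. The algebra $\mathbf M$ is dualizable if, for every $\mathbf A\in\mathbb{ISP}(\mathbf M)$, every continuous map $f\colon\hom(\mathbf A,\mathbf M)\to M$ that preserves all finitary compatible relations on $\mathbf M$ is an evaluation; otherwise it is non-dualizable.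 *)

theory Defs
  imports "HOL-Analysis.Analysis" "HOL-Library.Infinite_Typeclass"
begin

section \<open>Algebras with a single binary operation\<close>

text \<open>The values of \<^term>\<open>mul\<close> outside the universe are irrelevant throughout.\<close>

record 'a binalg =
  universe :: "'a set"
  mul :: "'a \<Rightarrow> 'a \<Rightarrow> 'a"

definition subuniverse :: "'a set \<Rightarrow> 'a binalg \<Rightarrow> bool" where
  "subuniverse S A \<longleftrightarrow> S \<subseteq> universe A \<and> (\<forall>x\<in>S. \<forall>y\<in>S. mul A x y \<in> S)"

definition binary_algebra :: "'a binalg \<Rightarrow> bool" where
  "binary_algebra A \<longleftrightarrow> universe A \<noteq> {} \<and> subuniverse (universe A) A"

definition is_subalgebra :: "'a binalg \<Rightarrow> 'a binalg \<Rightarrow> bool" where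
  "is_subalgebra B A \<longleftrightarrow> universe B \<noteq> {} \<and> subuniverse (universe B) A \<and>
     (\<forall>x\<in>universe B. \<forall>y\<in>universe B. mul B x y = mul A x y)"

definition power_alg :: "'a binalg \<Rightarrow> 'i set \<Rightarrow> ('i \<Rightarrow> 'a) binalg" where
  "power_alg M I = \<lparr>universe = I \<rightarrow>\<^sub>E universe M, mul = (\<lambda>x y. \<lambda>i\<in>I. mul M (x i) (y i))\<rparr>"

definition homs :: "'b binalg \<Rightarrow> 'a binalg \<Rightarrow> ('b \<Rightarrow> 'a) set" where
  "homs A M = {h \<in> universe A \<rightarrow>\<^sub>E universe M.
     \<forall>x\<in>universe A. \<forall>y\<in>universe A. h (mul A x y) = mul M (h x) (h y)}"

definition isomorphic :: "'b binalg \<Rightarrow> 'c binalg \<Rightarrow> bool" where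
  "isomorphic A B \<longleftrightarrow> (\<exists>h\<in>homs A B. bij_betw h (universe A) (universe B))"

text \<open>Isomorphic copies of subalgebras of powers. The index set is taken in the type of maps
  from \<open>A\<close> to \<open>M\<close>; this is no restriction, see \<open>in_ISP_any_index\<close> below.\<close>

definition in_ISP :: "'a binalg \<Rightarrow> 'b binalg \<Rightarrow> bool" where
  "in_ISP M A \<longleftrightarrow> binary_algebra A \<and>
     (\<exists>(I :: ('b \<Rightarrow> 'a) set) B. is_subalgebra B (power_alg M I) \<and> isomorphic A B)"


section \<open>Automatic algebras\<close>

definition automatic_algebra :: "'a binalg \<Rightarrow> bool" where
  "automatic_algebra M \<longleftrightarrow>
     (\<exists>Q S z (\<delta> :: 'a \<Rightarrow> 'a \<Rightarrow> 'a option).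
        Q \<inter> S = {} \<and> z \<notin> Q \<union> S \<and> universe M = Q \<union> S \<union> {z} \<and>
        (\<forall>a\<in>S. \<forall>q\<in>Q. \<forall>r. \<delta> a q = Some r \<longrightarrow> r \<in> Q) \<and>
        (\<forall>x\<in>universe M. \<forall>y\<in>universe M.
           mul M x y =
             (if x \<in> Q \<and> y \<in> S then (case \<delta> y x of Some r \<Rightarrow> r | None \<Rightarrow> z) else z)))"


section \<open>Dualizability\<close>

text \<open>A \<open>k\<close>-tuple is an extensional function on \<open>{..<k}\<close>.\<close>

definition compatible :: "'a binalg \<Rightarrow> nat \<Rightarrow> (nat \<Rightarrow> 'a) set \<Rightarrow> bool" where
  "compatible M k r \<longleftrightarrow> k \<ge> 1 \<and> subuniverse r (power_alg M {..<k})"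

definition hom_space :: "'b binalg \<Rightarrow> 'a binalg \<Rightarrow> ('b \<Rightarrow> 'a) topology" where
  "hom_space A M =
     subtopology (product_topology (\<lambda>_. discrete_topology (universe M)) (universe A)) (homs A M)"

definition preserves ::
  "'b binalg \<Rightarrow> 'a binalg \<Rightarrow> (('b \<Rightarrow> 'a) \<Rightarrow> 'a) \<Rightarrow> nat \<Rightarrow> (nat \<Rightarrow> 'a) set \<Rightarrow> bool" where
  "preserves A M f k r \<longleftrightarrow>
     (\<forall>x. (\<forall>i<k. x i \<in> homs A M) \<and> (\<forall>a\<in>universe A. (\<lambda>i\<in>{..<k}. x i a) \<in> r)
        \<longrightarrow> (\<lambda>i\<in>{..<k}. f (x i)) \<in> r)"

definition evaluation :: "'b binalg \<Rightarrow> 'a binalg \<Rightarrow> (('b \<Rightarrow> 'a) \<Rightarrow> 'a) \<Rightarrow> bool" where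
  "evaluation A M f \<longleftrightarrow> (\<exists>a\<in>universe A. \<forall>x\<in>homs A M. f x = x a)"

text \<open>A definition in HOL cannot range over algebras in all types, so the type \<open>'b\<close> in which the
  test algebras live is a parameter. For finite \<open>M\<close> the notion is the same for every infinite type
  \<open>'b\<close>, and it then implies the condition for test algebras in any type whatsoever:
  see \<open>dualizable_any_type\<close> and \<open>dualizable_type_independent\<close> below.\<close>

definition dualizable :: "'b itself \<Rightarrow> 'a binalg \<Rightarrow> bool" where
  "dualizable (_ :: 'b itself) M \<longleftrightarrow>
     (\<forall>(A :: 'b binalg) f.
        in_ISP M A \<and>
        continuous_map (hom_space A M) (discrete_topology (universe M)) f \<and>
        (\<forall>k r. compatible M k r \<longrightarrow> preserves A M f k r)
        \<longrightarrow> evaluation A M f)"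


section \<open>Independence of the ambient types\<close>

lemma separating_if_ISP:
  fixes I :: "'i set"
  assumes A: "binary_algebra A" and B: "is_subalgebra B (power_alg M I)" and iso: "isomorphic A B"
    and ab: "a \<in> universe A" "b \<in> universe A" "a \<noteq> b"
  shows "\<exists>x\<in>homs A M. x a \<noteq> x b"
proof -
  obtain h where h: "h \<in> homs A B" "bij_betw h (universe A) (universe B)"
    using iso by (auto simp: isomorphic_def)
  have hB: "h x \<in> universe B" if "x \<in> universe A" for x
    using h that by (auto simp: homs_def)
  have BP: "universe B \<subseteq> I \<rightarrow>\<^sub>E universe M"
    using B by (auto simp: is_subalgebra_def subuniverse_def power_alg_def)
  have ne: "h a \<noteq> h b" using h(2) ab by (auto simp: bij_betw_def inj_on_def)
  have "\<exists>i\<in>I. h a i \<noteq> h b i"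
  proof (rule ccontr)
    assume "\<not> ?thesis"
    then have "h a = h b" using BP hB[OF ab(1)] hB[OF ab(2)] by (intro PiE_ext[of _ I "\<lambda>_. universe M"]) auto
    with ne show False by simp
  qed
  then obtain i where i: "i \<in> I" "h a i \<noteq> h b i" by auto
  have mA: "mul A x y \<in> universe A" if "x \<in> universe A" "y \<in> universe A" for x y
    using A that by (auto simp: binary_algebra_def subuniverse_def)
  have "(\<lambda>c\<in>universe A. h c i) \<in> homs A M"
    unfolding homs_def
  proof (safe)
    fix x assume "x \<in> universe A"
    then show "(\<lambda>c\<in>universe A. h c i) x \<in> universe M" using hB BP i by (auto simp: PiE_iff)
  next
    fix x y assume xy: "x \<in> universe A" "y \<in> universe A"
    have "h (mul A x y) = mul B (h x) (h y)" using h xy by (auto simp: homs_def)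
    also have "\<dots> = mul (power_alg M I) (h x) (h y)"
      using B hB xy by (auto simp: is_subalgebra_def)
    finally show "(\<lambda>c\<in>universe A. h c i) (mul A x y)
        = mul M ((\<lambda>c\<in>universe A. h c i) x) ((\<lambda>c\<in>universe A. h c i) y)"
      using xy i mA by (simp add: power_alg_def)
  qed auto
  moreover have "(\<lambda>c\<in>universe A. h c i) a \<noteq> (\<lambda>c\<in>universe A. h c i) b" using i ab by simp
  ultimately show ?thesis by blast
qed

lemma ISP_if_separating:
  assumes A: "binary_algebra A"
    and sep: "\<And>a b. a \<in> universe A \<Longrightarrow> b \<in> universe A \<Longrightarrow> a \<noteq> b \<Longrightarrow> \<exists>x\<in>homs A M. x a \<noteq> x b"
  shows "in_ISP M A"
proof -
  define I where "I = homs A M"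
  define e where "e = (\<lambda>a\<in>universe A. \<lambda>x\<in>I. x a)"
  define B where "B = \<lparr>universe = e ` universe A, mul = mul (power_alg M I)\<rparr>"
  have mA: "mul A x y \<in> universe A" if "x \<in> universe A" "y \<in> universe A" for x y
    using A that by (auto simp: binary_algebra_def subuniverse_def)
  have em: "e (mul A x y) = mul (power_alg M I) (e x) (e y)"
    if "x \<in> universe A" "y \<in> universe A" for x y
    using that mA by (auto simp: e_def power_alg_def I_def homs_def fun_eq_iff)
  have em': "mul (power_alg M I) (e x) (e y) \<in> e ` universe A"
    if "x \<in> universe A" "y \<in> universe A" for x y
    using em[OF that] mA[OF that] by (metis image_eqI)
  have UB: "universe B = e ` universe A" and mB: "mul B = mul (power_alg M I)"
    by (simp_all add: B_def)
  have eP: "e a \<in> universe (power_alg M I)" if "a \<in> universe A" for a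
  proof -
    have "x a \<in> universe M" if "x \<in> I" for x
      using that \<open>a \<in> universe A\<close> by (auto simp: I_def homs_def)
    then show ?thesis using that by (simp add: e_def power_alg_def)
  qed
  have sub: "is_subalgebra B (power_alg M I)"
    unfolding is_subalgebra_def subuniverse_def
  proof (intro conjI ballI)
    show "universe B \<noteq> {}" using A by (simp add: UB binary_algebra_def)
    show "universe B \<subseteq> universe (power_alg M I)" using eP by (simp add: UB image_subset_iff)
    fix u v assume "u \<in> universe B" "v \<in> universe B"
    then show "mul (power_alg M I) u v \<in> universe B" using em' unfolding UB by blast
    show "mul B u v = mul (power_alg M I) u v" by (simp add: mB)
  qed
  have ee: "e \<in> extensional (universe A)" by (simp add: e_def)
  have "e \<in> homs A B"
    unfolding homs_def mem_Collect_eq UB mB PiE_def using em ee by blast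
  moreover have "inj_on e (universe A)"
  proof (rule inj_onI, rule ccontr)
    fix a b assume ab: "a \<in> universe A" "b \<in> universe A" "e a = e b" "a \<noteq> b"
    then obtain x where x: "x \<in> I" "x a \<noteq> x b" using sep unfolding I_def by blast
    have "e a x = x a" "e b x = x b" using ab(1,2) x(1) by (simp_all add: e_def)
    with ab(3) x(2) show False by simp
  qed
  ultimately have "isomorphic A B"
    unfolding isomorphic_def bij_betw_def UB by blast
  with A sub show ?thesis unfolding in_ISP_def by blast
qed

text \<open>Index sets of powers may be taken in any type.\<close>

lemma in_ISP_any_index:
  fixes I :: "'i set"
  assumes "binary_algebra A" "is_subalgebra B (power_alg M I)" "isomorphic A B"
  shows "in_ISP M A"
  by (rule ISP_if_separating[OF assms(1)]) (rule separating_if_ISP[OF assms])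

lemma openin_finite_coordinates:
  assumes "finite G" "G \<subseteq> J"
    and dep: "\<And>x y. \<lbrakk>x \<in> J \<rightarrow>\<^sub>E U; y \<in> J \<rightarrow>\<^sub>E U; \<forall>j\<in>G. x j = y j; P x\<rbrakk> \<Longrightarrow> P y"
  shows "openin (product_topology (\<lambda>_. discrete_topology U) J) {x \<in> J \<rightarrow>\<^sub>E U. P x}"
  unfolding openin_product_topology_alt
proof (intro ballI)
  fix x assume x: "x \<in> {x \<in> J \<rightarrow>\<^sub>E U. P x}"
  define W where "W = (\<lambda>j. if j \<in> G then {x j} else U)"
  have 1: "{i \<in> J. W i \<noteq> topspace (discrete_topology U)} \<subseteq> G" by (auto simp: W_def)
  have 2: "\<forall>i\<in>J. openin (discrete_topology U) (W i)" using x by (auto simp: W_def)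
  have 3: "x \<in> Pi\<^sub>E J W" using x by (auto simp: W_def PiE_iff)
  have 4: "Pi\<^sub>E J W \<subseteq> {x \<in> J \<rightarrow>\<^sub>E U. P x}"
  proof
    fix y assume y: "y \<in> Pi\<^sub>E J W"
    have WU: "W j \<subseteq> U" if "j \<in> J" for j using x that by (auto simp: W_def)
    have yU: "y \<in> J \<rightarrow>\<^sub>E U" using y WU by (meson PiE_mono subsetD)
    have "y j \<in> W j" if "j \<in> G" for j using y that assms(2) by (meson PiE_mem subsetD)
    then have "\<forall>j\<in>G. x j = y j" by (simp add: W_def)
    then show "y \<in> {x \<in> J \<rightarrow>\<^sub>E U. P x}" using dep[of x y] x yU by auto
  qed
  show "\<exists>Ua. finite {i \<in> J. Ua i \<noteq> topspace (discrete_topology U)} \<and>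
     (\<forall>i\<in>J. openin (discrete_topology U) (Ua i)) \<and> x \<in> Pi\<^sub>E J Ua \<and> Pi\<^sub>E J Ua \<subseteq> {x \<in> J \<rightarrow>\<^sub>E U. P x}"
    using 1 2 3 4 finite_subset[OF 1 assms(1)] by blast
qed

lemma closedin_finite_coordinates:
  assumes "finite G" "G \<subseteq> J"
    and dep: "\<And>x y. \<lbrakk>x \<in> J \<rightarrow>\<^sub>E U; y \<in> J \<rightarrow>\<^sub>E U; \<forall>j\<in>G. x j = y j; P x\<rbrakk> \<Longrightarrow> P y"
  shows "closedin (product_topology (\<lambda>_. discrete_topology U) J) {x \<in> J \<rightarrow>\<^sub>E U. P x}"
proof -
  have "openin (product_topology (\<lambda>_. discrete_topology U) J) {x \<in> J \<rightarrow>\<^sub>E U. \<not> P x}"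
    by (rule openin_finite_coordinates[OF assms(1,2)]) (metis dep)
  moreover have "(J \<rightarrow>\<^sub>E U) - {x \<in> J \<rightarrow>\<^sub>E U. P x} = {x \<in> J \<rightarrow>\<^sub>E U. \<not> P x}" by auto
  ultimately show ?thesis by (auto simp: closedin_def)
qed

lemma compact_finite_power:
  assumes "finite U"
  shows "compact_space (product_topology (\<lambda>_. discrete_topology U) J)"
  using assms by (simp add: compact_space_product_topology compact_space_discrete_topology)

lemma finite_constraints:
  assumes U: "finite U"
    and dep: "\<And>c. c \<in> C \<Longrightarrow> \<exists>G. finite G \<and> G \<subseteq> J \<and>
      (\<forall>x y. x \<in> J \<rightarrow>\<^sub>E U \<longrightarrow> y \<in> J \<rightarrow>\<^sub>E U \<longrightarrow> (\<forall>j\<in>G. x j = y j) \<longrightarrow> P c x \<longrightarrow> P c y)"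
    and fin: "\<And>D. finite D \<Longrightarrow> D \<subseteq> C \<Longrightarrow> \<exists>x\<in>J \<rightarrow>\<^sub>E U. \<forall>c\<in>D. P c x"
  shows "\<exists>x\<in>J \<rightarrow>\<^sub>E U. \<forall>c\<in>C. P c x"
proof (cases "C = {}")
  case True
  then show ?thesis using fin[of "{}"] by auto
next
  case False
  let ?X = "product_topology (\<lambda>_. discrete_topology U) J"
  let ?K = "\<lambda>c. {x \<in> J \<rightarrow>\<^sub>E U. P c x}"
  have "closedin ?X (?K c)" if c: "c \<in> C" for c
  proof -
    obtain G where g: "finite G" "G \<subseteq> J"
      "\<forall>x y. x \<in> J \<rightarrow>\<^sub>E U \<longrightarrow> y \<in> J \<rightarrow>\<^sub>E U \<longrightarrow> (\<forall>j\<in>G. x j = y j) \<longrightarrow> P c x \<longrightarrow> P c y"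
      using dep[OF c] by blast
    show ?thesis by (rule closedin_finite_coordinates[OF g(1,2)]) (use g(3) in blast)
  qed
  then have cl: "\<forall>K\<in>?K ` C. closedin ?X K" by auto
  have fip: "\<Inter>\<F> \<noteq> {}" if F: "finite \<F>" "\<F> \<subseteq> ?K ` C" for \<F>
  proof -
    obtain D where D: "finite D" "D \<subseteq> C" "\<F> = ?K ` D"
      using finite_subset_image[OF F] by blast
    then obtain x where "x \<in> J \<rightarrow>\<^sub>E U" "\<forall>c\<in>D. P c x" using fin by blast
    then have "x \<in> \<Inter>\<F>" using D by auto
    then show ?thesis by blast
  qed
  have "\<Inter>(?K ` C) \<noteq> {}"
    by (rule compact_finite_power[OF U, of J, unfolded compact_space_fip, THEN spec, THEN mp])
      (use cl fip in blast)
  then show ?thesis using False by auto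
qed

lemma continuous_map_finite_support:
  fixes A :: "'b binalg"
  assumes A: "binary_algebra A" and U: "finite (universe M)"
    and f: "continuous_map (hom_space A M) (discrete_topology (universe M)) f"
  shows "\<exists>F. finite F \<and> F \<subseteq> universe A \<and>
    (\<forall>x\<in>homs A M. \<forall>y\<in>homs A M. (\<forall>a\<in>F. x a = y a) \<longrightarrow> f x = f y)"
proof -
  let ?J = "universe A" and ?U = "universe M"
  let ?X = "product_topology (\<lambda>_. discrete_topology ?U) ?J"
  let ?H = "homs A M"
  have mA: "mul A x y \<in> universe A" if "x \<in> universe A" "y \<in> universe A" for x y
    using A that by (auto simp: binary_algebra_def subuniverse_def)
  have Hsub: "?H \<subseteq> topspace ?X" by (auto simp: homs_def)
  have Heq: "?H = {x \<in> ?J \<rightarrow>\<^sub>E ?U. True} \<inter> (\<Inter>p\<in>?J \<times> ?J. {x \<in> ?J \<rightarrow>\<^sub>E ?U.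
      x (mul A (fst p) (snd p)) = mul M (x (fst p)) (x (snd p))})"
    by (auto simp: homs_def)
  have ne: "?J \<times> ?J \<noteq> {}" using A by (auto simp: binary_algebra_def)
  have "closedin ?X ?H"
    unfolding Heq
  proof (intro closedin_Int closedin_INT ne)
    show "closedin ?X {x \<in> ?J \<rightarrow>\<^sub>E ?U. True}"
      by (rule closedin_finite_coordinates[of "{}"]) auto
    fix p assume "p \<in> ?J \<times> ?J"
    then show "closedin ?X {x \<in> ?J \<rightarrow>\<^sub>E ?U.
      x (mul A (fst p) (snd p)) = mul M (x (fst p)) (x (snd p))}"
      using mA by (intro closedin_finite_coordinates[of "{fst p, snd p, mul A (fst p) (snd p)}"]) auto
  qed
  then have cH: "compactin ?X ?H"
    using compact_finite_power[OF U] by (rule closedin_compact_space[rotated])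
  have "\<exists>G. finite G \<and> G \<subseteq> ?J \<and> (\<forall>y\<in>?H. (\<forall>a\<in>G. x a = y a) \<longrightarrow> f x = f y)" if x: "x \<in> ?H" for x
  proof -
    have top: "topspace (hom_space A M) = ?H" using Hsub by (auto simp: hom_space_def)
    have fx: "f x \<in> ?U" using f x top by (auto simp: continuous_map_def)
    have "openin (hom_space A M) {y \<in> topspace (hom_space A M). f y \<in> {f x}}"
      by (rule openin_continuous_map_preimage[OF f]) (use fx in auto)
    then obtain T where T: "openin ?X T" "{y \<in> ?H. f y = f x} = T \<inter> ?H"
      unfolding top by (auto simp: hom_space_def openin_subtopology)
    have "x \<in> T" using T x by blast
    then obtain V where V: "finite {i \<in> ?J. V i \<noteq> ?U}" "x \<in> Pi\<^sub>E ?J V" "Pi\<^sub>E ?J V \<subseteq> T"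
      using T(1) unfolding openin_product_topology_alt by auto
    have "f x = f y" if y: "y \<in> ?H" "\<forall>a\<in>{i \<in> ?J. V i \<noteq> ?U}. x a = y a" for y
    proof -
      have "y \<in> Pi\<^sub>E ?J V"
      proof (rule PiE_I)
        fix a assume a: "a \<in> ?J"
        show "y a \<in> V a"
        proof (cases "V a = ?U")
          case True then show ?thesis using y a by (auto simp: homs_def)
        next
          case False
          then have "y a = x a" using y a by auto
          then show ?thesis using V(2) a by auto
        qed
      next
        fix a assume "a \<notin> ?J"
        then show "y a = undefined" using y by (auto simp: homs_def PiE_iff extensional_def)
      qed
      then have "y \<in> T \<inter> ?H" using V y by auto
      then have "y \<in> {y \<in> ?H. f y = f x}" using T(2) by blast
      then show ?thesis by simp
    qed
    then show ?thesis using V(1) by (intro exI[of _ "{i \<in> ?J. V i \<noteq> ?U}"] conjI ballI impI) blast+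
  qed
  then obtain G where G: "\<And>x. x \<in> ?H \<Longrightarrow> finite (G x) \<and> G x \<subseteq> ?J \<and>
      (\<forall>y\<in>?H. (\<forall>a\<in>G x. x a = y a) \<longrightarrow> f x = f y)" by metis
  define V where "V = (\<lambda>x. {y \<in> ?J \<rightarrow>\<^sub>E ?U. \<forall>a\<in>G x. x a = y a})"
  have op: "openin ?X (V x)" if "x \<in> ?H" for x
    unfolding V_def
  proof (rule openin_finite_coordinates)
    show "finite (G x)" "G x \<subseteq> ?J" using G[OF that] by blast+
  qed simp
  have "?H \<subseteq> \<Union>(V ` ?H)" by (auto simp: V_def homs_def)
  then obtain \<F> where F: "finite \<F>" "\<F> \<subseteq> V ` ?H" "?H \<subseteq> \<Union>\<F>"
    using compactinD[OF cH, of "V ` ?H"] op by blast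
  obtain D where D: "finite D" "D \<subseteq> ?H" "\<F> = V ` D" using finite_subset_image[OF F(1,2)] by blast
  show ?thesis
  proof (intro exI[of _ "\<Union>(G ` D)"] conjI ballI impI)
    show "finite (\<Union>(G ` D))" "\<Union>(G ` D) \<subseteq> ?J" using D G by blast+
    fix x y assume xy: "x \<in> ?H" "y \<in> ?H" "\<forall>a\<in>\<Union>(G ` D). x a = y a"
    obtain d where d: "d \<in> D" "x \<in> V d" using F(3) D(3) xy(1) by blast
    have "f d = f x" "f d = f y"
      using G[of d] d D xy by (auto simp: V_def)
    then show "f x = f y" by simp
  qed
qed

lemma local_tuples_extend:
  fixes A :: "'b binalg" and k :: nat
  assumes A: "binary_algebra A" and U: "finite (universe M)" and F: "finite F" "F \<subseteq> universe A"
  shows "\<exists>G. finite G \<and> G \<subseteq> universe A \<and>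
    ((\<exists>x. (\<forall>i<k. \<forall>a\<in>universe A. x i a \<in> universe M) \<and>
        (\<forall>i<k. \<forall>a\<in>G. \<forall>b\<in>G. x i (mul A a b) = mul M (x i a) (x i b)) \<and>
        (\<forall>a\<in>G. (\<lambda>i\<in>{..<k}. x i a) \<in> r) \<and> (\<forall>i<k. \<forall>a\<in>F. x i a = p (i, a))) \<longrightarrow>
     (\<exists>y. (\<forall>i<k. y i \<in> homs A M) \<and> (\<forall>a\<in>universe A. (\<lambda>i\<in>{..<k}. y i a) \<in> r) \<and>
        (\<forall>i<k. \<forall>a\<in>F. y i a = p (i, a))))"
proof -
  define Q where "Q \<longleftrightarrow> (\<exists>y. (\<forall>i<k. y i \<in> homs A M) \<and>
        (\<forall>a\<in>universe A. (\<lambda>i\<in>{..<k}. y i a) \<in> r) \<and> (\<forall>i<k. \<forall>a\<in>F. y i a = p (i, a)))"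
  define L where "L = (\<lambda>G x. (\<forall>i<k. \<forall>a\<in>universe A. x i a \<in> universe M) \<and>
        (\<forall>i<k. \<forall>a\<in>G. \<forall>b\<in>G. x i (mul A a b) = mul M (x i a) (x i b)) \<and>
        (\<forall>a\<in>G. (\<lambda>i\<in>{..<k}. x i a) \<in> r) \<and> (\<forall>i<k. \<forall>a\<in>F. x i a = p (i, a)))"
  have "\<exists>G. finite G \<and> G \<subseteq> universe A \<and> ((\<exists>x. L G x) \<longrightarrow> Q)"
  proof (rule ccontr)
    assume neg: "\<not> (\<exists>G. finite G \<and> G \<subseteq> universe A \<and> ((\<exists>x. L G x) \<longrightarrow> Q))"
    have L: "\<exists>x. L G x" and Q: "\<not> Q" if "finite G" "G \<subseteq> universe A" for G
      using neg that by blast+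
    have mA: "mul A x y \<in> universe A" if "x \<in> universe A" "y \<in> universe A" for x y
      using A that by (auto simp: binary_algebra_def subuniverse_def)
    define J where "J = {..<k} \<times> universe A"
    define P :: "'b \<times> 'b \<Rightarrow> (nat \<times> 'b \<Rightarrow> 'a) \<Rightarrow> bool" where
      "P = (\<lambda>c x. (\<forall>i<k. x (i, mul A (fst c) (snd c)) = mul M (x (i, fst c)) (x (i, snd c))) \<and>
              (\<lambda>i\<in>{..<k}. x (i, fst c)) \<in> r \<and> (\<forall>i<k. \<forall>a\<in>F. x (i, a) = p (i, a)))"
    have "\<exists>x\<in>J \<rightarrow>\<^sub>E universe M. \<forall>c\<in>universe A \<times> universe A. P c x"
    proof (rule finite_constraints[OF U])
      fix c assume c: "c \<in> universe A \<times> universe A"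
      let ?G = "{..<k} \<times> (F \<union> {fst c, snd c, mul A (fst c) (snd c)})"
      have "finite ?G" "?G \<subseteq> J" using F c mA by (auto simp: J_def)
      moreover have "P c y" if eq: "\<forall>j\<in>?G. x j = y j" and Px: "P c x" for x y
      proof -
        have e: "\<And>i a. i < k \<Longrightarrow> a \<in> F \<union> {fst c, snd c, mul A (fst c) (snd c)} \<Longrightarrow> y (i, a) = x (i, a)"
          using eq by auto
        have "(\<lambda>i\<in>{..<k}. y (i, fst c)) = (\<lambda>i\<in>{..<k}. x (i, fst c))"
          using e by (intro restrict_ext) auto
        then show ?thesis using Px e unfolding P_def by simp
      qed
      ultimately show "\<exists>G. finite G \<and> G \<subseteq> J \<and> (\<forall>x y. x \<in> J \<rightarrow>\<^sub>E universe M \<longrightarrow>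
          y \<in> J \<rightarrow>\<^sub>E universe M \<longrightarrow> (\<forall>j\<in>G. x j = y j) \<longrightarrow> P c x \<longrightarrow> P c y)"
        by (intro exI[of _ ?G]) blast
    next
      fix D assume D: "finite D" "D \<subseteq> universe A \<times> universe A"
      let ?G = "fst ` D \<union> snd ` D"
      have "finite ?G" "?G \<subseteq> universe A" using D by auto
      then obtain x where "L ?G x" using L[of ?G] by blast
      note x = this[unfolded L_def, THEN conjunct1]
        this[unfolded L_def, THEN conjunct2, THEN conjunct1]
        this[unfolded L_def, THEN conjunct2, THEN conjunct2, THEN conjunct1]
        this[unfolded L_def, THEN conjunct2, THEN conjunct2, THEN conjunct2]
      define x' where "x' = (\<lambda>j\<in>J. x (fst j) (snd j))"
      have x'J: "x' \<in> J \<rightarrow>\<^sub>E universe M" using x(1) by (auto simp: x'_def J_def)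
      have e: "x' (i, a) = x i a" if "i < k" "a \<in> universe A" for i a
        using that by (simp add: x'_def J_def)
      have "P c x'" if c: "c \<in> D" for c
      proof -
        have c': "fst c \<in> universe A" "snd c \<in> universe A" "fst c \<in> ?G" "snd c \<in> ?G" using c D by auto
        have "(\<lambda>i\<in>{..<k}. x' (i, fst c)) = (\<lambda>i\<in>{..<k}. x i (fst c))"
          using e c' by (intro restrict_ext) auto
        then have 2: "(\<lambda>i\<in>{..<k}. x' (i, fst c)) \<in> r" using x(3) c' by metis
        have 1: "\<forall>i<k. x' (i, mul A (fst c) (snd c)) = mul M (x' (i, fst c)) (x' (i, snd c))"
          using e c' mA x(2) by metis
        have 3: "\<forall>i<k. \<forall>a\<in>F. x' (i, a) = p (i, a)" using e F x(4) by (metis subsetD)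
        show ?thesis unfolding P_def using 1 2 3 by blast
      qed
      then show "\<exists>x\<in>J \<rightarrow>\<^sub>E universe M. \<forall>c\<in>D. P c x" using x'J by blast
    qed
    then obtain x where xJ: "x \<in> J \<rightarrow>\<^sub>E universe M"
      and xP: "\<And>a b. a \<in> universe A \<Longrightarrow> b \<in> universe A \<Longrightarrow> P (a, b) x" by auto
    define y where "y = (\<lambda>i. \<lambda>a\<in>universe A. x (i, a))"
    have "y i \<in> homs A M" if "i < k" for i
      unfolding homs_def mem_Collect_eq
    proof (intro conjI ballI)
      show "y i \<in> universe A \<rightarrow>\<^sub>E universe M"
        using xJ that by (auto simp: y_def J_def)
      fix a b assume "a \<in> universe A" "b \<in> universe A"
      then show "y i (mul A a b) = mul M (y i a) (y i b)"
        using xP[of a b] mA that by (simp add: y_def P_def)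
    qed
    moreover have "(\<lambda>i\<in>{..<k}. y i a) \<in> r" if "a \<in> universe A" for a
      using xP[OF that that] that by (simp add: P_def y_def)
    moreover have "\<forall>i<k. \<forall>a\<in>F. y i a = p (i, a)"
    proof -
      obtain a where "a \<in> universe A" using A by (auto simp: binary_algebra_def)
      then show ?thesis using xP[of a a] F by (auto simp: P_def y_def)
    qed
    ultimately have Q unfolding Q_def by blast
    then show False using Q[of "{}"] by simp
  qed
  then show ?thesis unfolding L_def Q_def .
qed

lemma countable_subuniverse:
  assumes A: "binary_algebra A" and S: "countable S" "S \<subseteq> universe A"
  shows "\<exists>T. countable T \<and> S \<subseteq> T \<and> subuniverse T A"
proof -
  define R where "R = rec_nat S (\<lambda>_ T. T \<union> (\<lambda>(a, b). mul A a b) ` (T \<times> T))"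
  have R0: "R 0 = S" and RS: "\<And>n. R (Suc n) = R n \<union> (\<lambda>(a, b). mul A a b) ` (R n \<times> R n)"
    by (auto simp: R_def)
  have c: "countable (R n)" for n
    by (induction n) (auto simp: R0 RS S)
  have u: "R n \<subseteq> universe A" for n
    by (induction n) (use A S in \<open>auto simp: R0 RS binary_algebra_def subuniverse_def\<close>)
  have mono: "R m \<subseteq> R n" if "m \<le> n" for m n
    using that by (induction rule: dec_induct) (auto simp: RS)
  have "mul A a b \<in> (\<Union>n. R n)" if ab: "a \<in> R m" "b \<in> R n" for a b m n
  proof -
    have "a \<in> R (max m n)" "b \<in> R (max m n)" using ab mono[of m "max m n"] mono[of n "max m n"] by auto
    then have "mul A a b \<in> R (Suc (max m n))" unfolding RS by auto
    then show ?thesis by blast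
  qed
  then have "subuniverse (\<Union>n. R n) A" using u unfolding subuniverse_def by blast
  then show ?thesis using c R0 by (intro exI[of _ "\<Union>n. R n"]) auto
qed

theorem dualizable_any_type:
  fixes M :: "'a binalg"
  assumes M: "binary_algebra M" and U: "finite (universe M)"
    and dual: "dualizable TYPE('c::infinite) M"
  shows "dualizable TYPE('b) M"
  unfolding dualizable_def
proof (intro allI impI, elim conjE)
  fix A :: "'b binalg" and f
  assume ISP: "in_ISP M A"
    and cont: "continuous_map (hom_space A M) (discrete_topology (universe M)) f"
    and pres: "\<forall>k r. compatible M k r \<longrightarrow> preserves A M f k r"
  have A: "binary_algebra A" using ISP by (simp add: in_ISP_def)
  have sepA: "\<exists>x\<in>homs A M. x a \<noteq> x b" if "a \<in> universe A" "b \<in> universe A" "a \<noteq> b" for a b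
    using ISP separating_if_ISP[OF A _ _ that] unfolding in_ISP_def by blast
  obtain F where F: "finite F" "F \<subseteq> universe A"
    and supp: "\<And>x y. x \<in> homs A M \<Longrightarrow> y \<in> homs A M \<Longrightarrow> (\<forall>a\<in>F. x a = y a) \<Longrightarrow> f x = f y"
    using continuous_map_finite_support[OF A U cont] by blast
  define Q where "Q = (\<lambda>(k::nat) r p. \<exists>y. (\<forall>i<k. y i \<in> homs A M) \<and>
        (\<forall>a\<in>universe A. (\<lambda>i\<in>{..<k}. y i a) \<in> r) \<and> (\<forall>i<k. \<forall>a\<in>F. y i a = p (i, a)))"
  define L where "L = (\<lambda>G (k::nat) r p x. (\<forall>i<k. \<forall>a\<in>universe A. x i a \<in> universe M) \<and>
        (\<forall>i<k. \<forall>a\<in>G. \<forall>b\<in>G. x i (mul A a b) = mul M (x i a) (x i b)) \<and>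
        (\<forall>a\<in>G. (\<lambda>i\<in>{..<k}. x i a) \<in> r) \<and> (\<forall>i<k. \<forall>a\<in>F. x i a = p (i, a)))"
  have "\<exists>G. finite G \<and> G \<subseteq> universe A \<and> ((\<exists>x. L G k r p x) \<longrightarrow> Q k r p)" for k r p
    unfolding L_def Q_def by (rule local_tuples_extend[OF A U F])
  then obtain G where G: "\<And>k r p. finite (G k r p)" "\<And>k r p. G k r p \<subseteq> universe A"
    "\<And>k r p x. L (G k r p) k r p x \<Longrightarrow> Q k r p"
    by metis
  define N where "N = (SIGMA k:(UNIV :: nat set).
      Pow ({..<k} \<rightarrow>\<^sub>E universe M) \<times> (({..<k} \<times> F) \<rightarrow>\<^sub>E universe M))"
  have "finite (Pow ({..<k} \<rightarrow>\<^sub>E universe M) \<times> (({..<k} \<times> F) \<rightarrow>\<^sub>E universe M))" for k :: nat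
    using U F by (simp add: finite_PiE)
  then have "countable N" unfolding N_def by (intro countable_SIGMA countable_finite[of "Pow _ \<times> _"]) auto
  define S where "S = F \<union> (\<Union>t\<in>N. G (fst t) (fst (snd t)) (snd (snd t)))"
  have "countable S" unfolding S_def
    by (intro countable_Un countable_UN countable_finite[OF F(1)] countable_finite[OF G(1)]
        \<open>countable N\<close>)
  moreover have "S \<subseteq> universe A"
    unfolding S_def by (intro Un_least UN_least F(2) G(2))
  moreover obtain a0 where a0: "a0 \<in> universe A" using A by (auto simp: binary_algebra_def)
  ultimately have "countable (insert a0 S)" "insert a0 S \<subseteq> universe A" by auto
  then obtain T where T: "countable T" "insert a0 S \<subseteq> T" "subuniverse T A"
    using countable_subuniverse[OF A, of "insert a0 S"] by metis
  have TA: "T \<subseteq> universe A" and mT: "\<And>a b. a \<in> T \<Longrightarrow> b \<in> T \<Longrightarrow> mul A a b \<in> T"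
    using T(3) by (auto simp: subuniverse_def)
  have "F \<subseteq> S" unfolding S_def by (rule Un_upper1)
  then have FT: "F \<subseteq> T" using T(2) by blast
  obtain e :: "nat \<Rightarrow> 'c" where e: "inj e"
    using infinite_UNIV infinite_countable_subset[of "UNIV :: 'c set"] by blast
  define j where "j = e \<circ> to_nat_on T"
  have j: "inj_on j T" unfolding j_def
    using T(1) e by (intro comp_inj_on inj_on_to_nat_on) (auto intro: inj_on_subset)
  define g where "g = inv_into T j"
  have gj [simp]: "g (j a) = a" if "a \<in> T" for a using that j by (simp add: g_def)
  define C where "C = \<lparr>universe = j ` T, mul = (\<lambda>u v. j (mul A (g u) (g v)))\<rparr>"
  have UC: "universe C = j ` T" and mC: "\<And>a b. a \<in> T \<Longrightarrow> b \<in> T \<Longrightarrow> mul C (j a) (j b) = j (mul A a b)"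
    by (auto simp: C_def)
  have algC: "binary_algebra C"
    using T mT mC by (auto simp: binary_algebra_def subuniverse_def UC)
  define tr where "tr = (\<lambda>(x :: 'b \<Rightarrow> 'a). \<lambda>u\<in>universe C. x (g u))"
  have trj: "tr x (j a) = x a" if "a \<in> T" for x a using that by (simp add: tr_def UC)
  have tr: "tr x \<in> homs C M" if "x \<in> homs A M" for x
    unfolding homs_def mem_Collect_eq
  proof (intro conjI ballI)
    show "tr x \<in> universe C \<rightarrow>\<^sub>E universe M"
      using that TA by (auto simp: tr_def UC homs_def)
    fix u v assume "u \<in> universe C" "v \<in> universe C"
    then obtain a b where ab: "a \<in> T" "b \<in> T" "u = j a" "v = j b" by (auto simp: UC)
    then have "x (mul A a b) = mul M (x a) (x b)" using that TA by (auto simp: homs_def)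
    then show "tr x (mul C u v) = mul M (tr x u) (tr x v)" using ab by (simp add: mC mT trj)
  qed
  have ISPC: "in_ISP M C"
  proof (rule ISP_if_separating[OF algC])
    fix u v assume "u \<in> universe C" "v \<in> universe C" "u \<noteq> v"
    then obtain a b where ab: "a \<in> T" "b \<in> T" "u = j a" "v = j b" "a \<noteq> b" by (auto simp: UC)
    then obtain x where "x \<in> homs A M" "x a \<noteq> x b" using sepA[of a b] TA by auto
    then show "\<exists>x\<in>homs C M. x u \<noteq> x v" using tr[of x] trj ab by (intro bexI[of _ "tr x"]) auto
  qed
  have ext: "\<exists>y. (\<forall>i<k. y i \<in> homs A M) \<and> (\<forall>a\<in>universe A. (\<lambda>i\<in>{..<k}. y i a) \<in> r) \<and>
        (\<forall>i<k. \<forall>a\<in>F. y i a = z i (j a))"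
    if r: "r \<subseteq> {..<k} \<rightarrow>\<^sub>E universe M" and z: "\<And>i. i < k \<Longrightarrow> z i \<in> homs C M"
      and zr: "\<And>u. u \<in> universe C \<Longrightarrow> (\<lambda>i\<in>{..<k}. z i u) \<in> r" for k :: nat and r z
  proof -
    define p where "p = (\<lambda>q\<in>{..<k} \<times> F. z (fst q) (j (snd q)))"
    have zU: "z i (j a) \<in> universe M" if "i < k" "a \<in> T" for i a
      using z[OF that(1)] that(2) by (auto simp: homs_def UC)
    have "(k, r, p) \<in> N" using r zU FT by (auto simp: N_def p_def)
    then have "G k r p \<subseteq> S" by (force simp: S_def)
    then have GT: "G k r p \<subseteq> T" using T(2) by blast
    obtain m where m: "m \<in> universe M" using M by (auto simp: binary_algebra_def)
    define x where "x = (\<lambda>i a. if a \<in> T then z i (j a) else m)"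
    have "L (G k r p) k r p x"
      unfolding L_def
    proof (intro conjI allI impI ballI)
      fix i a assume "i < k"
      then show "x i a \<in> universe M" using zU m by (auto simp: x_def)
    next
      fix i a b assume "i < k" "a \<in> G k r p" "b \<in> G k r p"
      then have ab: "a \<in> T" "b \<in> T" "i < k" using GT by auto
      then have "z i (mul C (j a) (j b)) = mul M (z i (j a)) (z i (j b))"
        using z[of i] by (auto simp: homs_def UC)
      then show "x i (mul A a b) = mul M (x i a) (x i b)"
        using ab by (simp add: x_def mT mC)
    next
      fix a assume "a \<in> G k r p"
      then have "a \<in> T" using GT by blast
      then show "(\<lambda>i\<in>{..<k}. x i a) \<in> r" using zr[of "j a"] by (simp add: x_def UC)
    next
      fix i a assume "i < k" "a \<in> F"
      then show "x i a = p (i, a)" using FT by (auto simp: x_def p_def)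
    qed
    then have "Q k r p" by (rule G(3))
    moreover have "p (i, a) = z i (j a)" if "i < k" "a \<in> F" for i a
      using that by (simp add: p_def)
    ultimately show ?thesis unfolding Q_def by auto
  qed
  define ex where "ex = (\<lambda>z. SOME y. y \<in> homs A M \<and> (\<forall>a\<in>F. y a = z (j a)))"
  have ex: "ex z \<in> homs A M \<and> (\<forall>a\<in>F. ex z a = z (j a))" if z: "z \<in> homs C M" for z
  proof -
    have "\<exists>y. (\<forall>i<Suc 0. y i \<in> homs A M) \<and>
        (\<forall>a\<in>universe A. (\<lambda>i\<in>{..<Suc 0}. y i a) \<in> ({..<Suc 0} \<rightarrow>\<^sub>E universe M)) \<and>
        (\<forall>i<Suc 0. \<forall>a\<in>F. y i a = z (j a))"
      using z by (intro ext) (auto simp: homs_def)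
    then obtain y where "y (0::nat) \<in> homs A M \<and> (\<forall>a\<in>F. y 0 a = z (j a))" by auto
    then have "\<exists>y. y \<in> homs A M \<and> (\<forall>a\<in>F. y a = z (j a))" by (rule exI[of _ "y 0"])
    then show ?thesis unfolding ex_def by (rule someI_ex)
  qed
  define f0 where "f0 = (\<lambda>z. f (ex z))"
  have topA: "topspace (hom_space A M) = homs A M"
    by (auto simp: hom_space_def homs_def)
  have topC: "topspace (hom_space C M) = homs C M"
    by (auto simp: hom_space_def homs_def)
  have fU: "f x \<in> universe M" if "x \<in> homs A M" for x
    using cont that topA by (auto simp: continuous_map_def)
  have f0_supp: "f0 z = f0 w" if "z \<in> homs C M" "w \<in> homs C M" "\<forall>u\<in>j ` F. z u = w u" for z w
    unfolding f0_def by (rule supp) (use ex that in auto)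
  have "continuous_map (hom_space C M) (discrete_topology (universe M)) f0"
    unfolding continuous_map_def
  proof (intro conjI allI impI)
    show "f0 \<in> topspace (hom_space C M) \<rightarrow> topspace (discrete_topology (universe M))"
      using topC fU ex by (auto simp: f0_def)
    fix V
    let ?P = "\<lambda>x. \<exists>z\<in>homs C M. (\<forall>u\<in>j ` F. z u = x u) \<and> f0 z \<in> V"
    have "openin (product_topology (\<lambda>_. discrete_topology (universe M)) (universe C))
       {x \<in> universe C \<rightarrow>\<^sub>E universe M. ?P x}"
    proof (rule openin_finite_coordinates)
      show "finite (j ` F)" "j ` F \<subseteq> universe C" using F FT by (auto simp: UC)
    qed simp
    moreover have "{x \<in> topspace (hom_space C M). f0 x \<in> V} =
       {x \<in> universe C \<rightarrow>\<^sub>E universe M. ?P x} \<inter> homs C M"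
    proof -
      have "?P x \<longleftrightarrow> f0 x \<in> V" if "x \<in> homs C M" for x using f0_supp that by metis
      then show ?thesis unfolding topC by (auto simp: homs_def)
    qed
    ultimately show "openin (hom_space C M) {x \<in> topspace (hom_space C M). f0 x \<in> V}"
      unfolding hom_space_def openin_subtopology by blast
  qed
  moreover have "preserves C M f0 k r" if kr: "compatible M k r" for k r
    unfolding preserves_def
  proof (intro allI impI, elim conjE)
    fix z assume z: "\<forall>i<k. z i \<in> homs C M" "\<forall>u\<in>universe C. (\<lambda>i\<in>{..<k}. z i u) \<in> r"
    have "r \<subseteq> {..<k} \<rightarrow>\<^sub>E universe M"
      using kr by (auto simp: compatible_def subuniverse_def power_alg_def)
    then obtain y where y: "\<forall>i<k. y i \<in> homs A M" "\<forall>a\<in>universe A. (\<lambda>i\<in>{..<k}. y i a) \<in> r"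
        "\<forall>i<k. \<forall>a\<in>F. y i a = z i (j a)"
      using ext[of r k z] z by metis
    have "preserves A M f k r" using pres kr by blast
    then have "(\<lambda>i\<in>{..<k}. f (y i)) \<in> r"
      using y(1,2) unfolding preserves_def by metis
    moreover have "f0 (z i) = f (y i)" if "i < k" for i
      unfolding f0_def by (rule supp) (use ex[of "z i"] z y that in auto)
    then have "(\<lambda>i\<in>{..<k}. f0 (z i)) = (\<lambda>i\<in>{..<k}. f (y i))" by (intro restrict_ext) auto
    ultimately show "(\<lambda>i\<in>{..<k}. f0 (z i)) \<in> r" by simp
  qed
  ultimately have "evaluation C M f0"
    using dual ISPC unfolding dualizable_def by blast
  then obtain a where a: "a \<in> T" "\<And>z. z \<in> homs C M \<Longrightarrow> f0 z = z (j a)"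
    by (auto simp: evaluation_def UC)
  have "f x = x a" if x: "x \<in> homs A M" for x
  proof -
    have "f x = f0 (tr x)"
      unfolding f0_def by (rule supp) (use ex[OF tr[OF x]] trj FT x in auto)
    also have "\<dots> = x a" using a tr[OF x] trj by simp
    finally show ?thesis .
  qed
  then show "evaluation A M f" using a TA by (auto simp: evaluation_def)
qed

corollary dualizable_type_independent:
  fixes M :: "'a binalg"
  assumes "binary_algebra M" "finite (universe M)"
  shows "dualizable TYPE('b::infinite) M \<longleftrightarrow> dualizable TYPE('c::infinite) M"
  by (rule iffI) (rule dualizable_any_type[OF assms]; assumption)+

end

theory Submission
  imports Defs "HOL-Number_Theory.Cong"
begin

text \<open>
  All algebras of the chain are assembled from blocks. Block \<open>b\<close> has the residues modulo a prime
  \<open>p\<^sub>b \<ge> 5\<close> as states, the primes being distinct for different blocks; its letters are residues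
  acting by translation, and letters of one block are undefined on the states of the others.
  The algebra \<open>cyclic_blocks c d\<close> has \<open>d\<close> blocks, of which the first \<open>c\<close> are complete
  (all translations are letters), whereas the others only have the letters \<open>0\<close> and \<open>1\<close>. The chain
  starts with one complete block, then alternately opens a new block with two letters and
  completes it. So its odd members consist of complete blocks only, and its even members have
  exactly one incomplete block. What matters is that the letters \<open>{0, 1}\<close>, unlike all residues, do not
  form a subgroup.

  \<^bold>\<open>Complete blocks are dualizable.\<close> For a continuous map \<open>f\<close> on the homomorphisms that preserves all
  compatible relations, two facts suffice: \<open>f\<close> depends on finitely many coordinates \<open>F\<close>, and it agrees
  on every finite set of homomorphisms with the evaluation at some element. If \<open>f\<close> takes a letter
  as a value, these elements can be confined to \<open>F\<close>, so one of them works for all homomorphisms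
  (\<open>evaluation_if_letter\<close>). If all values are states or \<open>0\<close> and some value is a state, then among the
  homomorphisms into a single block, those on which \<open>f\<close> is a state are the ones above a least
  \<open>x0\<close>, that is, with states and letters at least where \<open>x0\<close> has them (\<open>least_state_hom\<close>).
  The elements that \<open>x0\<close> sends to states are connected by multiplication with the elements that it
  sends to letters (\<open>connected\<close>), and hence finitely many of them
  have a common lower bound: this yields an element that is sent to a state exactly
  when \<open>f\<close> is a state (\<open>bottom\<close>). To adjust its value, consider the homomorphisms with
  the same support as \<open>x0\<close>. Because all translations are letters, those into one block form a vector
  space over the field with \<open>p\<^sub>b\<close> elements, on which \<open>f\<close> is linear; so \<open>f\<close> is a linear combination of
  the coordinates in \<open>F\<close> (\<open>functional_combination\<close>). The Chinese remainder theorem makes the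
  coefficients independent of the block, and the combination is realized by multiplying with letters
  (\<open>value_on_K0\<close>).

  \<^bold>\<open>An incomplete block destroys dualizability.\<close> Over a block with modulus \<open>p\<close> and letters \<open>{0, 1}\<close>
  take the algebra of all finitely supported sequences of states with sum \<open>1\<close> and all indicator
  sequences of \<open>p\<close>-element sets as letters. A homomorphism that does not annihilate the unit sequences
  \<open>e i\<close> must be constant on them with at most one exception: two exceptions would force a letter to take
  a value outside \<open>{0, 1}\<close>. Homomorphisms into the other blocks send these letters to \<open>0\<close>, since the
  moduli are coprime, and are constant on the \<open>e i\<close> as well. The value taken on almost all \<open>e i\<close> defines a continuous map that preserves all
  relations. Evaluated at the coordinates it is the zero sequence of states, whose sum is \<open>0\<close>, so it is
  not an evaluation (\<open>majority_not_evaluation\<close>).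
\<close>

section \<open>The chain of algebras\<close>

definition modulus :: "nat \<Rightarrow> nat" where
  "modulus b = enumerate {p. prime p \<and> 5 \<le> p} b"

text \<open>States and letters are coded as odd and as positive even numbers, so that all members of the chain
  share one multiplication.\<close>

definition state :: "nat \<Rightarrow> nat \<Rightarrow> nat" where
  "state b k = 2 * prod_encode (b, k) + 1"

definition letter :: "nat \<Rightarrow> nat \<Rightarrow> nat" where
  "letter b k = 2 * prod_encode (b, k) + 2"

definition is_state :: "nat \<Rightarrow> bool" where
  "is_state x \<longleftrightarrow> odd x"

definition is_letter :: "nat \<Rightarrow> bool" where
  "is_letter x \<longleftrightarrow> even x \<and> x \<noteq> 0"

definition block :: "nat \<Rightarrow> nat" where
  "block x = fst (prod_decode ((x - 1) div 2))"

definition val :: "nat \<Rightarrow> nat" where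
  "val x = snd (prod_decode ((x - 1) div 2))"

definition act :: "nat \<Rightarrow> nat \<Rightarrow> nat" where
  "act x y = (if is_state x \<and> is_letter y \<and> block x = block y
     then state (block x) ((val x + val y) mod modulus (block x)) else 0)"

definition cyclic_blocks :: "nat \<Rightarrow> nat \<Rightarrow> nat binalg" where
  "cyclic_blocks c d = \<lparr>universe = {0} \<union> {state b k | b k. b < d \<and> k < modulus b}
     \<union> {letter b k | b k. b < d \<and> k < modulus b \<and> (b < c \<or> k < 2)}, mul = act\<rparr>"

lemma infinite_primes_from_5: "infinite {p::nat. prime p \<and> 5 \<le> p}"
proof
  assume "finite {p::nat. prime p \<and> 5 \<le> p}"
  then have "finite ({p. prime p \<and> 5 \<le> p} \<union> {..<5::nat})" by simp
  moreover have "{p::nat. prime p} \<subseteq> {p. prime p \<and> 5 \<le> p} \<union> {..<5}" by auto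
  ultimately show False using primes_infinite finite_subset by blast
qed

lemma prime_modulus: "prime (modulus b)" and modulus_ge_5: "5 \<le> modulus b"
  using enumerate_in_set[OF infinite_primes_from_5, of b] by (auto simp: modulus_def)

lemma modulus_pos [simp]: "0 < modulus b"
  using modulus_ge_5[of b] by linarith

lemma coprime_modulus:
  assumes "b \<noteq> b'" shows "coprime (modulus b) (modulus b')"
proof (rule primes_coprime[OF prime_modulus prime_modulus])
  show "modulus b \<noteq> modulus b'"
    unfolding modulus_def using inj_enumerate[OF infinite_primes_from_5] assms by (simp only: inj_eq not_False_eq_True)
qed

lemma is_state_state [simp]: "is_state (state b k)" "\<not> is_letter (state b k)"
  and is_letter_letter [simp]: "is_letter (letter b k)" "\<not> is_state (letter b k)"
  and not_zero [simp]: "\<not> is_state 0" "\<not> is_letter 0" "state b k \<noteq> 0" "letter b k \<noteq> 0"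
  by (auto simp: is_state_def is_letter_def state_def letter_def)

lemma block_val [simp]:
  "block (state b k) = b" "val (state b k) = k" "block (letter b k) = b" "val (letter b k) = k"
proof -
  have "(2 * prod_encode (b, k) + 2 - 1) div 2 = prod_encode (b, k)" by linarith
  then show "block (state b k) = b" "val (state b k) = k" "block (letter b k) = b" "val (letter b k) = k"
    by (simp_all add: block_def val_def state_def letter_def)
qed

lemma state_or_letter: "is_state x \<or> is_letter x \<longleftrightarrow> x \<noteq> 0" "\<not> (is_state x \<and> is_letter x)"
  by (auto simp: is_state_def is_letter_def odd_pos)

lemma nonzero: "is_state x \<Longrightarrow> x \<noteq> 0" "is_letter x \<Longrightarrow> x \<noteq> 0"
  by (auto simp: is_state_def is_letter_def odd_pos)

lemma state_block_val [simp]: "is_state x \<Longrightarrow> state (block x) (val x) = x"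
  by (auto simp: is_state_def state_def block_def val_def)

lemma letter_block_val [simp]: "is_letter x \<Longrightarrow> letter (block x) (val x) = x"
proof -
  assume "is_letter x"
  then have "even x" "x \<noteq> 0" by (auto simp: is_letter_def)
  then have "2 * ((x - 1) div 2) + 2 = x" by presburger
  then show ?thesis by (simp add: letter_def block_def val_def)
qed

lemma mul_cyclic_blocks [simp]: "mul (cyclic_blocks c d) = act"
  by (simp add: cyclic_blocks_def)

lemma universe_iff: "x \<in> universe (cyclic_blocks c d) \<longleftrightarrow>
   x = 0 \<or> (block x < d \<and> val x < modulus (block x) \<and> (is_letter x \<longrightarrow> block x < c \<or> val x < 2))"
  (is "?L \<longleftrightarrow> ?R")
proof
  assume ?L then show ?R by (auto simp: cyclic_blocks_def)
next
  assume R: ?R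
  consider "x = 0" | "is_state x" | "is_letter x" using state_or_letter by blast
  then show ?L
  proof cases
    case 1 then show ?thesis by (simp add: cyclic_blocks_def)
  next
    case 2
    then have "block x < d" "val x < modulus (block x)"
      using R nonzero by auto
    then have "state (block x) (val x) \<in> universe (cyclic_blocks c d)"
      unfolding cyclic_blocks_def by auto
    then show ?thesis using 2 by simp
  next
    case 3
    then have "block x < d" "val x < modulus (block x)" "block x < c \<or> val x < 2"
      using R nonzero by auto
    then have "letter (block x) (val x) \<in> universe (cyclic_blocks c d)"
      unfolding cyclic_blocks_def by auto
    then show ?thesis using 3 by simp
  qed
qed

lemma zero_in_universe [simp]: "0 \<in> universe (cyclic_blocks c d)"
  by (simp add: universe_iff)

lemma state_in_universe [simp]:
  "state b k \<in> universe (cyclic_blocks c d) \<longleftrightarrow> b < d \<and> k < modulus b"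
  by (simp add: universe_iff)

lemma letter_in_universe [simp]:
  "letter b k \<in> universe (cyclic_blocks c d) \<longleftrightarrow> b < d \<and> k < modulus b \<and> (b < c \<or> k < 2)"
  by (simp add: universe_iff)

lemma is_state_act [simp]: "is_state (act x y) \<longleftrightarrow> is_state x \<and> is_letter y \<and> block x = block y"
  and not_letter_act [simp]: "\<not> is_letter (act x y)"
  and act_eq_0: "act x y = 0 \<longleftrightarrow> \<not> (is_state x \<and> is_letter y \<and> block x = block y)"
  by (auto simp: act_def)

lemma block_act: "is_state (act x y) \<Longrightarrow> block (act x y) = block x"
  and val_act: "is_state (act x y) \<Longrightarrow> val (act x y) = (val x + val y) mod modulus (block x)"
  by (auto simp: act_def)

lemma finite_cyclic_blocks: "finite (universe (cyclic_blocks c d))"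
proof -
  have "universe (cyclic_blocks c d) \<subseteq> {0} \<union>
     (\<lambda>(b, k). state b k) ` (SIGMA b:{..<d}. {..<modulus b}) \<union>
     (\<lambda>(b, k). letter b k) ` (SIGMA b:{..<d}. {..<modulus b})"
    unfolding cyclic_blocks_def by auto
  then show ?thesis by (rule finite_subset) simp
qed

lemma subuniverse_cyclic_blocks:
  "d \<le> d' \<Longrightarrow> c \<le> c' \<Longrightarrow> subuniverse (universe (cyclic_blocks c d)) (cyclic_blocks c' d')"
proof -
  assume "d \<le> d'" "c \<le> c'"
  then have "universe (cyclic_blocks c d) \<subseteq> universe (cyclic_blocks c' d')"
    by (auto simp: universe_iff)
  moreover have "act x y \<in> universe (cyclic_blocks c d)"
    if "x \<in> universe (cyclic_blocks c d)" for x y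
    using that nonzero by (auto simp: act_def universe_iff)
  ultimately show ?thesis by (simp add: subuniverse_def)
qed

lemma binary_algebra_cyclic_blocks: "binary_algebra (cyclic_blocks c d)"
  using subuniverse_cyclic_blocks[of d d c c] zero_in_universe unfolding binary_algebra_def by blast

lemma automatic_cyclic_blocks: "automatic_algebra (cyclic_blocks c d)"
proof -
  let ?U = "universe (cyclic_blocks c d)"
  let ?Q = "{x \<in> ?U. is_state x}" and ?S = "{x \<in> ?U. is_letter x}"
  let ?\<delta> = "\<lambda>y x. if act x y = 0 then None else Some (act x y)"
  have 1: "?Q \<inter> ?S = {}" using state_or_letter(2) by auto
  have 2: "?U = ?Q \<union> ?S \<union> {0}" using state_or_letter(1) zero_in_universe by blast
  have closed: "act q a \<in> ?U" if "q \<in> ?U" "a \<in> ?U" for q a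
    using binary_algebra_cyclic_blocks[of c d] that by (simp add: binary_algebra_def subuniverse_def)
  have 3: "\<forall>a\<in>?S. \<forall>q\<in>?Q. \<forall>r. ?\<delta> a q = Some r \<longrightarrow> r \<in> ?Q"
  proof (intro ballI allI impI)
    fix a q r assume "a \<in> ?S" "q \<in> ?Q" "?\<delta> a q = Some r"
    then have "r = act q a" "act q a \<noteq> 0" "q \<in> ?U" "a \<in> ?U" by (auto split: if_splits)
    then show "r \<in> ?Q" using closed state_or_letter(1)[of "act q a"] not_letter_act by blast
  qed
  have 4: "mul (cyclic_blocks c d) x y =
      (if x \<in> ?Q \<and> y \<in> ?S then (case ?\<delta> y x of Some r \<Rightarrow> r | None \<Rightarrow> 0) else 0)"
    if "x \<in> ?U" "y \<in> ?U" for x y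
  proof (cases "is_state x \<and> is_letter y")
    case True then show ?thesis using that by simp
  next
    case False then show ?thesis by (auto simp: act_def)
  qed
  have "0 \<notin> ?Q \<union> ?S" by simp
  then show ?thesis unfolding automatic_algebra_def
    by (intro exI[of _ ?Q] exI[of _ ?S] exI[of _ 0] exI[of _ ?\<delta>] conjI ballI 1 2 3 4)
qed

section \<open>Linear functionals modulo a prime\<close>

text \<open>The hypotheses describe a vector space \<open>K\<close> of tuples given by the coordinates \<open>e\<close> over the field
  with \<open>p\<close> elements and a linear map \<open>f\<close> that vanishes where the coordinates in \<open>F\<close> do. Working with
  congruences avoids a type for the field. The proof eliminates one coordinate at a time: if \<open>y\<close> is
  supported on the coordinate \<open>a\<close> alone, then \<open>f\<close> minus a suitable multiple of this coordinate
  depends on the others only.\<close>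

lemma functional_combination:
  fixes e :: "'x \<Rightarrow> 'i \<Rightarrow> int" and f :: "'x \<Rightarrow> int" and p :: int
  assumes p: "prime p" and F: "finite F"
    and closed: "\<And>x y n. x \<in> K \<Longrightarrow> y \<in> K \<Longrightarrow>
      \<exists>z\<in>K. (\<forall>i\<in>F. [e z i = e x i + n * e y i] (mod p)) \<and> [f z = f x + n * f y] (mod p)"
    and supp: "\<And>x. x \<in> K \<Longrightarrow> (\<forall>i\<in>F. [e x i = 0] (mod p)) \<Longrightarrow> [f x = 0] (mod p)"
  shows "\<exists>c. \<forall>x\<in>K. [f x = (\<Sum>i\<in>F. c i * e x i)] (mod p)"
  using F closed supp
proof (induction F arbitrary: f rule: finite_induct)
  case empty then show ?case by simp
next
  case (insert a F)
  show ?case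
  proof (cases "\<exists>y\<in>K. (\<forall>i\<in>F. [e y i = 0] (mod p)) \<and> \<not> [e y a = 0] (mod p)")
    case False
    have "\<exists>c. \<forall>x\<in>K. [f x = (\<Sum>i\<in>F. c i * e x i)] (mod p)"
    proof (rule insert.IH)
      fix x y n assume "x \<in> K" "y \<in> K"
      then show "\<exists>z\<in>K. (\<forall>i\<in>F. [e z i = e x i + n * e y i] (mod p)) \<and> [f z = f x + n * f y] (mod p)"
        using insert.prems(1)[of x y n] by auto
    next
      fix x assume "x \<in> K" "\<forall>i\<in>F. [e x i = 0] (mod p)"
      then show "[f x = 0] (mod p)" using insert.prems(2)[of x] False by auto
    qed
    then obtain c where c: "\<forall>x\<in>K. [f x = (\<Sum>i\<in>F. c i * e x i)] (mod p)" ..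
    have "(\<Sum>i\<in>insert a F. (c(a := 0)) i * e x i) = (\<Sum>i\<in>F. c i * e x i)" for x
      using insert.hyps by (auto intro!: sum.cong)
    then show ?thesis using c by metis
  next
    case True
    then obtain y where y: "y \<in> K" "\<forall>i\<in>F. [e y i = 0] (mod p)" "\<not> [e y a = 0] (mod p)" by blast
    have "coprime (e y a) p"
      using y(3) prime_imp_coprime[OF p] cong_0_iff coprime_commute by metis
    then obtain w where w: "[e y a * w = 1] (mod p)" using cong_solve_coprime_int by blast
    \<comment> \<open>\<open>w * f y\<close> is the only possible coefficient at \<open>a\<close>, by the value at \<open>y\<close>.\<close>
    define g where "g = (\<lambda>x. f x - w * f y * e x a)"
    have "\<exists>c. \<forall>x\<in>K. [g x = (\<Sum>i\<in>F. c i * e x i)] (mod p)"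
    proof (rule insert.IH)
      fix x x' n assume "x \<in> K" "x' \<in> K"
      then obtain z where z: "z \<in> K" "\<forall>i\<in>insert a F. [e z i = e x i + n * e x' i] (mod p)"
        "[f z = f x + n * f x'] (mod p)" using insert.prems(1)[of x x' n] by auto
      have "[g z = (f x + n * f x') - w * f y * (e x a + n * e x' a)] (mod p)"
        unfolding g_def using z by (intro cong_diff cong_mult cong_refl) auto
      then have "[g z = g x + n * g x'] (mod p)" by (simp add: g_def algebra_simps)
      with z show "\<exists>z\<in>K. (\<forall>i\<in>F. [e z i = e x i + n * e x' i] (mod p)) \<and> [g z = g x + n * g x'] (mod p)"
        by auto
    next
      fix x assume x: "x \<in> K" "\<forall>i\<in>F. [e x i = 0] (mod p)"
      obtain z where z: "z \<in> K" "\<forall>i\<in>insert a F. [e z i = e x i + - (e x a * w) * e y i] (mod p)"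
        "[f z = f x + - (e x a * w) * f y] (mod p)"
        using insert.prems(1)[OF x(1) y(1), of "- (e x a * w)"] by auto
      have "[e z i = 0] (mod p)" if "i \<in> insert a F" for i
      proof (cases "i = a")
        case True
        have "[e z a = e x a - e x a * (e y a * w)] (mod p)" using z(2) by (simp add: algebra_simps)
        also have "[e x a - e x a * (e y a * w) = e x a - e x a * 1] (mod p)"
          using w by (intro cong_diff cong_mult cong_refl)
        finally show ?thesis using True by simp
      next
        case False
        then have i: "i \<in> F" using that by simp
        have "[e z i = e x i + - (e x a * w) * e y i] (mod p)" using z(2) i by simp
        also have "[e x i + - (e x a * w) * e y i = 0 + - (e x a * w) * 0] (mod p)"
          using x(2) y(2) i by (intro cong_add cong_mult cong_refl) auto
        finally show ?thesis by simp
      qed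
      then have "[f z = 0] (mod p)" using insert.prems(2)[OF z(1)] by blast
      then have "[f x + - (e x a * w) * f y = 0] (mod p)" using z(3) cong_trans cong_sym by blast
      then show "[g x = 0] (mod p)" by (simp add: g_def algebra_simps)
    qed
    then obtain c where c: "\<forall>x\<in>K. [g x = (\<Sum>i\<in>F. c i * e x i)] (mod p)" ..
    have "[f x = (\<Sum>i\<in>insert a F. (c(a := w * f y)) i * e x i)] (mod p)" if x: "x \<in> K" for x
    proof -
      have "(\<Sum>i\<in>insert a F. (c(a := w * f y)) i * e x i) = w * f y * e x a + (\<Sum>i\<in>F. c i * e x i)"
        using insert.hyps by (auto intro!: sum.cong)
      moreover have "[w * f y * e x a + g x = w * f y * e x a + (\<Sum>i\<in>F. c i * e x i)] (mod p)"
        using c x by (intro cong_add cong_refl) auto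
      ultimately show ?thesis by (simp add: g_def)
    qed
    then show ?thesis by blast
  qed
qed


section \<open>Local evaluations with finite support\<close>

lemma state_not_letter [simp]: "is_state x \<Longrightarrow> \<not> is_letter x"
  using state_or_letter(2) by blast

definition same_kind :: "nat \<Rightarrow> nat \<Rightarrow> bool" where
  "same_kind x y \<longleftrightarrow> is_state x \<and> is_state y \<or> is_letter x \<and> is_letter y"

text \<open>Continuity of \<open>f\<close> enters only through the finite support \<open>F\<close>, the preservation of the compatible
  relations only through the last assumption.\<close>

locale local_evaluation =
  fixes c :: nat and A :: "'b binalg" and f :: "('b \<Rightarrow> nat) \<Rightarrow> nat" and F :: "'b set"
  assumes algebra: "binary_algebra A"
    and F: "finite F" "F \<subseteq> universe A"
    and support: "\<And>x y. x \<in> homs A (cyclic_blocks c c) \<Longrightarrow> y \<in> homs A (cyclic_blocks c c) \<Longrightarrow>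
      (\<And>a. a \<in> F \<Longrightarrow> x a = y a) \<Longrightarrow> f x = f y"
    and local: "\<And>X. finite X \<Longrightarrow> X \<subseteq> homs A (cyclic_blocks c c) \<Longrightarrow>
      \<exists>a\<in>universe A. \<forall>x\<in>X. f x = x a"
begin

abbreviation U where "U \<equiv> universe A"
abbreviation H where "H \<equiv> homs A (cyclic_blocks c c)"
abbreviation prod (infixl "\<cdot>" 70) where "u \<cdot> v \<equiv> mul A u v"

lemma prod_closed [simp]: "u \<in> U \<Longrightarrow> v \<in> U \<Longrightarrow> u \<cdot> v \<in> U"
  using algebra by (simp add: binary_algebra_def subuniverse_def)

lemma hom_prod: "x \<in> H \<Longrightarrow> u \<in> U \<Longrightarrow> v \<in> U \<Longrightarrow> x (u \<cdot> v) = act (x u) (x v)"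
  by (simp add: homs_def)

lemma hom_range: "x \<in> H \<Longrightarrow> u \<in> U \<Longrightarrow> x u \<in> universe (cyclic_blocks c c)"
  by (auto simp: homs_def)

lemma hom_val: "x \<in> H \<Longrightarrow> u \<in> U \<Longrightarrow> x u \<noteq> 0 \<Longrightarrow> block (x u) < c \<and> val (x u) < modulus (block (x u))"
  using hom_range[of x u] by (auto simp: universe_iff)

definition cut :: "('b \<Rightarrow> nat) \<Rightarrow> 'b set \<Rightarrow> 'b \<Rightarrow> nat" where
  "cut x W = (\<lambda>u\<in>U. if u \<in> W then x u else 0)"

lemma cut_apply [simp]: "u \<in> U \<Longrightarrow> cut x W u = (if u \<in> W then x u else 0)"
  by (simp add: cut_def)

text \<open>Setting a homomorphism to zero outside a set that respects its nonzero products is the way in which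
  all smaller homomorphisms below arise.\<close>

lemma cut_hom:
  assumes x: "x \<in> H"
    and W: "\<And>u v. u \<in> U \<Longrightarrow> v \<in> U \<Longrightarrow> is_state (x (u \<cdot> v)) \<Longrightarrow> u \<cdot> v \<in> W \<longleftrightarrow> u \<in> W \<and> v \<in> W"
  shows "cut x W \<in> H"
proof -
  have "cut x W u \<in> universe (cyclic_blocks c c)" if "u \<in> U" for u
    using hom_range[OF x that] that by simp
  moreover have "cut x W (u \<cdot> v) = act (cut x W u) (cut x W v)" if uv: "u \<in> U" "v \<in> U" for u v
  proof (cases "is_state (x (u \<cdot> v))")
    case True
    then show ?thesis using W[OF uv True] uv hom_prod[OF x uv] act_eq_0 by auto
  next
    case False
    then have "x (u \<cdot> v) = 0" using hom_prod[OF x uv] act_eq_0 by auto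
    then have "act (x u) (x v) = 0" using hom_prod[OF x uv] by simp
    then have "act (cut x W u) (cut x W v) = 0" using uv by (auto simp: act_eq_0)
    then show ?thesis using \<open>x (u \<cdot> v) = 0\<close> uv by simp
  qed
  moreover have "cut x W \<in> extensional U" by (simp add: cut_def)
  ultimately show ?thesis by (auto simp: homs_def PiE_iff)
qed

text \<open>The homomorphisms into a single block. For these a product is nonzero as soon as its factors are a state
  and a letter, see \<open>H1_prod\<close>.\<close>

definition H1 :: "('b \<Rightarrow> nat) set" where
  "H1 = {x \<in> H. \<exists>b. \<forall>u\<in>U. x u \<noteq> 0 \<longrightarrow> block (x u) = b}"

lemma H1_hom: "x \<in> H1 \<Longrightarrow> x \<in> H"
  by (simp add: H1_def)

lemma H1_prod:
  assumes "x \<in> H1" "u \<in> U" "v \<in> U"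
  shows "is_state (x (u \<cdot> v)) \<longleftrightarrow> is_state (x u) \<and> is_letter (x v)"
proof -
  have "block (x u) = block (x v)" if "is_state (x u)" "is_letter (x v)"
    using assms that nonzero by (auto simp: H1_def)
  then show ?thesis using assms by (auto simp: hom_prod H1_hom)
qed

lemma not_letter_prod: "x \<in> H \<Longrightarrow> u \<in> U \<Longrightarrow> v \<in> U \<Longrightarrow> \<not> is_letter (x (u \<cdot> v))"
  by (simp add: hom_prod)

lemma cut_H1:
  assumes x: "x \<in> H1"
    and W: "\<And>u v. u \<in> U \<Longrightarrow> v \<in> U \<Longrightarrow> is_state (x u) \<Longrightarrow> is_letter (x v) \<Longrightarrow>
      u \<cdot> v \<in> W \<longleftrightarrow> u \<in> W \<and> v \<in> W"
  shows "cut x W \<in> H1"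
proof -
  have "cut x W \<in> H" using W H1_prod[OF x] by (intro cut_hom H1_hom x) auto
  moreover have "\<exists>b. \<forall>u\<in>U. cut x W u \<noteq> 0 \<longrightarrow> block (cut x W u) = b"
    using x by (auto simp: H1_def)
  ultimately show ?thesis by (simp add: H1_def)
qed

lemma cut_same_kind:
  assumes x: "x \<in> H1" and S: "S \<subseteq> H1"
  shows "cut x {u. \<forall>y\<in>S. same_kind (y u) (x u)} \<in> H1"
proof (rule cut_H1[OF x])
  fix u v assume uv: "u \<in> U" "v \<in> U" "is_state (x u)" "is_letter (x v)"
  then have st: "is_state (x (u \<cdot> v))" using H1_prod[OF x] by blast
  have "same_kind (y (u \<cdot> v)) (x (u \<cdot> v)) \<longleftrightarrow> same_kind (y u) (x u) \<and> same_kind (y v) (x v)"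
    if "y \<in> S" for y
    using H1_prod[of y u v] that S st uv by (auto simp: same_kind_def)
  then show "u \<cdot> v \<in> {u. \<forall>y\<in>S. same_kind (y u) (x u)} \<longleftrightarrow>
      u \<in> {u. \<forall>y\<in>S. same_kind (y u) (x u)} \<and> v \<in> {u. \<forall>y\<in>S. same_kind (y u) (x u)}"
    by blast
qed

lemma cut_block:
  assumes x: "x \<in> H" shows "cut x {u. block (x u) = b} \<in> H1"
proof -
  have "cut x {u. block (x u) = b} \<in> H"
    using block_act by (intro cut_hom x) (auto simp: hom_prod[OF x])
  then show ?thesis by (auto simp: H1_def intro!: exI[of _ b])
qed

text \<open>No product is ever sent to a letter. Therefore a homomorphism stays one when only its letter values
  at some elements of \<open>F\<close> are kept. On the resulting \<open>x2\<close> the value of \<open>f\<close> is still a letter, so any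
  element that evaluates \<open>f\<close> on \<open>x2\<close> lies in the finite set \<open>F\<close>; if each element of \<open>F\<close> failed at
  some homomorphism, \<open>f\<close> would have no local evaluation at these together with \<open>x2\<close>.\<close>

lemma evaluation_if_letter:
  assumes x: "x \<in> H" and l: "is_letter (f x)"
  shows "evaluation A (cyclic_blocks c c) f"
proof (rule ccontr)
  assume "\<not> ?thesis"
  then have "\<forall>a\<in>U. \<exists>y\<in>H. f y \<noteq> y a" by (simp add: evaluation_def)
  then obtain y where y: "\<And>a. a \<in> U \<Longrightarrow> y a \<in> H" "\<And>a. a \<in> U \<Longrightarrow> f (y a) \<noteq> y a a" by metis
  define x1 where "x1 = cut x {u. is_letter (x u)}"
  define x2 where "x2 = cut x {u \<in> F. is_letter (x u)}"
  have x1: "x1 \<in> H" unfolding x1_def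
    using not_letter_prod[OF x] by (intro cut_hom x) (auto simp: hom_prod[OF x])
  have x2: "x2 \<in> H" unfolding x2_def
    using not_letter_prod[OF x] by (intro cut_hom x) (auto simp: hom_prod[OF x])
  have l1: "is_letter (f x1)"
  proof -
    obtain a where "a \<in> U" "f x = x a" "f x1 = x1 a" using local[of "{x, x1}"] x x1 by auto
    then show ?thesis using l by (simp add: x1_def)
  qed
  obtain a where a: "a \<in> U" "f x1 = x1 a" "f x2 = x2 a" "\<forall>a'\<in>F. f (y a') = y a' a"
    using local[of "insert x1 (insert x2 (y ` F))"] x1 x2 y F by auto
  have "f x2 = f x1" using F(2) by (intro support x1 x2) (auto simp: x1_def x2_def)
  then have "x2 a \<noteq> 0" using l1 a nonzero by metis
  then have "a \<in> F" using a(1) by (auto simp: x2_def split: if_splits)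
  then show False using a y(2) by auto
qed

lemma evaluation_if_zero:
  assumes "\<And>x. x \<in> H \<Longrightarrow> f x = 0"
  shows "evaluation A (cyclic_blocks c c) f"
proof -
  obtain u where u: "u \<in> U" using algebra by (auto simp: binary_algebra_def)
  have "x (u \<cdot> u) = 0" if "x \<in> H" for x
    using that u by (auto simp: hom_prod act_eq_0)
  then show ?thesis unfolding evaluation_def using assms u prod_closed by (intro bexI[of _ "u \<cdot> u"]) auto
qed

text \<open>Intersecting the supports of all homomorphisms with a state as value of \<open>f\<close> again gives such a
  homomorphism: only the finitely many members of \<open>F\<close> matter for its value, so it may be replaced by
  an intersection with finitely many of them, and there \<open>f\<close> is an evaluation.\<close>

lemma least_state_hom:
  assumes x: "x \<in> H" and s: "is_state (f x)"
  shows "\<exists>x0\<in>H1. is_state (f x0) \<and>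
    (\<forall>y\<in>H1. is_state (f y) \<longrightarrow> (\<forall>u\<in>U. x0 u \<noteq> 0 \<longrightarrow> same_kind (y u) (x0 u)))"
proof -
  define x1 where "x1 = cut x {u. block (x u) = block (f x)}"
  have x1: "x1 \<in> H1" unfolding x1_def by (rule cut_block[OF x])
  obtain a where "a \<in> U" "f x = x a" "f x1 = x1 a"
    using local[of "{x, x1}"] x H1_hom[OF x1] by auto
  then have s1: "is_state (f x1)" using s by (simp add: x1_def)
  define K where "K = {y \<in> H1. is_state (f y)}"
  define m where "m = (\<lambda>S. cut x1 {u. \<forall>y\<in>S. same_kind (y u) (x1 u)})"
  have m: "m S \<in> H1" if "S \<subseteq> K" for S
    unfolding m_def using that by (intro cut_same_kind x1) (auto simp: K_def)
  have "\<exists>y\<in>K. \<not> same_kind (y u) (x1 u)" if "u \<in> F" "\<not> (\<forall>y\<in>K. same_kind (y u) (x1 u))" for u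
    using that by blast
  then obtain w where w: "\<And>u. u \<in> F \<Longrightarrow> \<not> (\<forall>y\<in>K. same_kind (y u) (x1 u)) \<Longrightarrow>
      w u \<in> K \<and> \<not> same_kind (w u u) (x1 u)" by metis
  define S where "S = w ` {u \<in> F. \<not> (\<forall>y\<in>K. same_kind (y u) (x1 u))}"
  have S: "finite S" "S \<subseteq> K" unfolding S_def using F(1) w by auto
  have "f (m K) = f (m S)"
  proof (rule support)
    show "m K \<in> H" "m S \<in> H" using m S(2) H1_hom by auto
    fix u assume u: "u \<in> F"
    then have "(\<forall>y\<in>K. same_kind (y u) (x1 u)) \<longleftrightarrow> (\<forall>y\<in>S. same_kind (y u) (x1 u))"
      using w S(2) unfolding S_def by blast
    then show "m K u = m S u" using u F(2) unfolding m_def by (simp add: subset_iff)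
  qed
  moreover obtain a where a: "a \<in> U" "f x1 = x1 a" "f (m S) = m S a" "\<forall>y\<in>S. f y = y a"
    using local[of "insert x1 (insert (m S) S)"] x1 m S H1_hom by (auto simp: K_def subset_iff)
  then have "f (m S) = f x1" using S(2) s1 by (auto simp: m_def K_def same_kind_def)
  ultimately have "is_state (f (m K))" using s1 by simp
  moreover have "same_kind (y u) (m K u)" if "y \<in> K" "u \<in> U" "m K u \<noteq> 0" for y u
    using that by (auto simp: m_def split: if_splits)
  ultimately show ?thesis using m[of K] by (intro bexI[of _ "m K"]) (auto simp: K_def)
qed

end

section \<open>Local evaluations with a state as a value\<close>

locale least_state_evaluation = local_evaluation c A f F
  for c :: nat and A :: "'b binalg" and f and F +
  fixes x0 :: "'b \<Rightarrow> nat"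
  assumes no_letter: "\<And>x. x \<in> H \<Longrightarrow> \<not> is_letter (f x)"
    and x0: "x0 \<in> H1" "is_state (f x0)"
    and least: "\<And>x u. x \<in> H1 \<Longrightarrow> is_state (f x) \<Longrightarrow> u \<in> U \<Longrightarrow> x0 u \<noteq> 0 \<Longrightarrow> same_kind (x u) (x0 u)"
begin

definition P where "P = {u \<in> U. is_state (x0 u)}"
definition V where "V = {v \<in> U. is_letter (x0 v)}"

lemma P_U: "u \<in> P \<Longrightarrow> u \<in> U" and V_U: "v \<in> V \<Longrightarrow> v \<in> U"
  by (auto simp: P_def V_def)

lemma P_V_disjoint: "u \<in> P \<Longrightarrow> u \<notin> V"
  by (auto simp: P_def V_def)

lemma x0_eq_0: "u \<in> U \<Longrightarrow> u \<notin> P \<Longrightarrow> u \<notin> V \<Longrightarrow> x0 u = 0"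
  using state_or_letter(1) by (auto simp: P_def V_def)

lemma prod_P_iff: "u \<in> U \<Longrightarrow> v \<in> U \<Longrightarrow> u \<cdot> v \<in> P \<longleftrightarrow> u \<in> P \<and> v \<in> V"
  using H1_prod[OF x0(1), of u v] by (auto simp: P_def V_def)

lemma prod_P: "u \<in> P \<Longrightarrow> v \<in> V \<Longrightarrow> u \<cdot> v \<in> P"
  by (simp add: prod_P_iff P_U V_U)

lemma prod_not_V: "u \<in> U \<Longrightarrow> v \<in> U \<Longrightarrow> u \<cdot> v \<notin> V"
  using not_letter_prod[OF H1_hom[OF x0(1)]] by (auto simp: V_def)

lemma local_P:
  assumes "finite X" "X \<subseteq> H" shows "\<exists>a\<in>P. \<forall>x\<in>X. f x = x a"
proof -
  obtain a where "a \<in> U" "\<forall>x\<in>insert x0 X. f x = x a"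
    using local[of "insert x0 X"] assms x0(1) H1_hom by auto
  then show ?thesis using x0(2) by (intro bexI[of _ a]) (auto simp: P_def)
qed

lemma local_P_single:
  assumes "x \<in> H" obtains a where "a \<in> P" "f x = x a"
  using local_P[of "{x}"] assms by auto

lemma local_P_pair:
  assumes "x \<in> H" "y \<in> H" obtains a where "a \<in> P" "f x = x a" "f y = y a"
  using local_P[of "{x, y}"] assms by auto

lemma state_on_P: "x \<in> H1 \<Longrightarrow> is_state (f x) \<Longrightarrow> u \<in> P \<Longrightarrow> is_state (x u)"
  using least[of x u] nonzero by (auto simp: P_def same_kind_def)

lemma letter_on_V: "x \<in> H1 \<Longrightarrow> is_state (f x) \<Longrightarrow> v \<in> V \<Longrightarrow> is_letter (x v)"
  using least[of x v] nonzero by (auto simp: V_def same_kind_def)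

text \<open>Cutting \<open>x0\<close> down to the support of \<open>x\<close> does not change it on \<open>F\<close>, and a local evaluation at both
  carries the state from the smaller homomorphism to \<open>x\<close>.\<close>

lemma state_if_on_F:
  assumes x: "x \<in> H1" and st: "\<And>u. u \<in> F \<inter> P \<Longrightarrow> is_state (x u)"
    and lt: "\<And>v. v \<in> F \<inter> V \<Longrightarrow> is_letter (x v)"
  shows "is_state (f x)"
proof -
  define y where "y = cut x0 {u. \<forall>z\<in>{x}. same_kind (z u) (x0 u)}"
  have y: "y \<in> H1" unfolding y_def using x by (intro cut_same_kind x0) auto
  have "f y = f x0"
  proof (rule support)
    show "y \<in> H" "x0 \<in> H" using y x0 H1_hom by auto
    fix u assume u: "u \<in> F"
    then have yu: "y u = (if same_kind (x u) (x0 u) then x0 u else 0)" using F(2) by (auto simp: y_def)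
    consider "u \<in> P" | "u \<in> V" | "u \<notin> P" "u \<notin> V" by blast
    then show "y u = x0 u"
    proof cases
      case 1 then show ?thesis using st[of u] u yu by (simp add: same_kind_def P_def)
    next
      case 2 then show ?thesis using lt[of u] u yu by (simp add: same_kind_def V_def)
    next
      case 3 then show ?thesis using x0_eq_0[of u] u F(2) yu by auto
    qed
  qed
  moreover obtain a where "a \<in> P" "f x = x a" "f y = y a"
    using local_P_pair H1_hom x y by blast
  ultimately have "y a = f x0" "a \<in> U" "is_state (x0 a)" by (auto simp: P_def)
  then have "same_kind (x a) (x0 a)" using x0(2) nonzero(1)[of "f x0"] by (auto simp: y_def split: if_splits)
  then show ?thesis using \<open>is_state (x0 a)\<close> \<open>f x = x a\<close> by (simp add: same_kind_def)
qed

text \<open>The graph of right multiplication by \<open>V\<close> on \<open>P\<close>; its connected components are the smallest parts of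
  \<open>P\<close> to which \<open>x0\<close> can be cut down.\<close>

definition step :: "'b \<Rightarrow> 'b \<Rightarrow> bool" where
  "step u u' \<longleftrightarrow> u \<in> P \<and> (\<exists>v\<in>V. u' = u \<cdot> v)"

lemma cut_component:
  assumes W: "W \<subseteq> P" "\<And>u v. u \<in> P \<Longrightarrow> v \<in> V \<Longrightarrow> u \<cdot> v \<in> W \<longleftrightarrow> u \<in> W"
  shows "cut x0 (W \<union> V) \<in> H1"
proof (rule cut_H1[OF x0(1)])
  fix u v assume uv: "u \<in> U" "v \<in> U" "is_state (x0 u)" "is_letter (x0 v)"
  then have "u \<in> P" "v \<in> V" by (auto simp: P_def V_def)
  then show "u \<cdot> v \<in> W \<union> V \<longleftrightarrow> u \<in> W \<union> V \<and> v \<in> W \<union> V"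
    using W prod_not_V[of u v] uv P_V_disjoint[of u] by auto
qed

text \<open>Keep only the components of \<open>x0\<close> that meet \<open>F\<close>. The value of \<open>f\<close> stays the same, so it is evaluated at
  an element of one of these components. Then \<open>f\<close> is a state already on the restriction of \<open>x0\<close> to this
  component, which by minimality of \<open>x0\<close> is all of \<open>P\<close>.\<close>

lemma connected:
  assumes "u \<in> P" "u' \<in> P" shows "equivclp step u u'"
proof -
  define y where "y = (\<lambda>T. cut x0 ({w \<in> P. \<exists>t\<in>T. equivclp step t w} \<union> V))"
  have y: "y T \<in> H1" for T
    unfolding y_def
  proof (rule cut_component)
    fix u v assume "u \<in> P" "v \<in> V"
    then have "step u (u \<cdot> v)" by (auto simp: step_def)
    then have "equivclp step t (u \<cdot> v) \<longleftrightarrow> equivclp step t u" for t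
      by (meson equivclp_into_equivclp equivclp_sym equivclp_trans r_into_equivclp)
    then show "u \<cdot> v \<in> {w \<in> P. \<exists>t\<in>T. equivclp step t w} \<longleftrightarrow> u \<in> {w \<in> P. \<exists>t\<in>T. equivclp step t w}"
      using prod_P \<open>u \<in> P\<close> \<open>v \<in> V\<close> by auto
  qed auto
  have yF: "f (y (F \<inter> P)) = f x0"
  proof (rule support)
    show "y (F \<inter> P) \<in> H" "x0 \<in> H" using y x0 H1_hom by auto
    fix u assume u: "u \<in> F"
    define Z where "Z = {w \<in> P. \<exists>t\<in>F \<inter> P. equivclp step t w}"
    have Z: "u \<in> Z" if "u \<in> P"
      unfolding Z_def using u that equivclp_refl[of step u] by blast
    have uU: "u \<in> U" using u F(2) by blast
    have yZ: "y (F \<inter> P) u = (if u \<in> Z \<union> V then x0 u else 0)"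
      unfolding y_def Z_def by (rule cut_apply[OF uU])
    show "y (F \<inter> P) u = x0 u"
    proof (cases "u \<in> Z \<union> V")
      case True then show ?thesis using yZ by simp
    next
      case False
      then have "x0 u = 0" using Z by (intro x0_eq_0 uU) auto
      then show ?thesis using yZ by simp
    qed
  qed
  have yP: "y T w = (if \<exists>t\<in>T. equivclp step t w then x0 w else 0)" if w: "w \<in> P" for T w
    unfolding y_def cut_apply[OF P_U[OF w]] using w P_V_disjoint[OF w] by simp
  have yH: "y T \<in> H" for T using H1_hom[OF y] .
  define X where "X = insert (y (F \<inter> P)) ((\<lambda>t. y {t}) ` (F \<inter> P))"
  have "finite X" "X \<subseteq> H" using F(1) yH unfolding X_def by blast+
  then obtain a where aX: "a \<in> P" "\<forall>x\<in>X. f x = x a" using local_P[of X] by blast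
  have a: "a \<in> P" "f (y (F \<inter> P)) = y (F \<inter> P) a" by (fact aX(1)) (rule bspec[OF aX(2)], simp add: X_def)
  have at: "f (y {t}) = y {t} a" if "t \<in> F \<inter> P" for t
    by (rule bspec[OF aX(2)]) (use that in \<open>simp add: X_def\<close>)
  have "y (F \<inter> P) a \<noteq> 0" using a(2) yF nonzero(1)[OF x0(2)] by metis
  then obtain t where t: "t \<in> F \<inter> P" "equivclp step t a"
    unfolding yP[OF a(1)] by metis
  have "f (y {t}) = x0 a" using at[OF t(1)] yP[OF a(1), of "{t}"] t(2) by simp
  then have st: "is_state (f (y {t}))" using a(1) by (simp add: P_def)
  have "equivclp step t w" if w: "w \<in> P" for w
    using nonzero(1)[OF state_on_P[OF y st w]] yP[OF w, of "{t}"] by (metis singletonD)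
  then show ?thesis using assms equivclp_sym equivclp_trans by metis
qed

definition below :: "'b \<Rightarrow> 'b \<Rightarrow> bool" where
  "below p u \<longleftrightarrow> (\<forall>x\<in>H1. is_state (x p) \<longrightarrow> is_state (x u))"

lemma below_trans: "below p q \<Longrightarrow> below q u \<Longrightarrow> below p u"
  by (auto simp: below_def)

lemma below_refl: "below p p"
  by (auto simp: below_def)

lemma below_prod: "u \<in> U \<Longrightarrow> v \<in> U \<Longrightarrow> below (u \<cdot> v) u"
  by (auto simp: below_def H1_prod)

lemma below_prod_trans: "p \<in> P \<Longrightarrow> v \<in> V \<Longrightarrow> below p q \<Longrightarrow> below (p \<cdot> v) q"
  by (rule below_trans[OF below_prod]) (auto simp: P_U V_U)

text \<open>Walk from \<open>u\<close> to \<open>u'\<close> and repeat each forward step at the lower bound found so far; backward steps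
  need no change.\<close>

lemma common_lower_bound:
  assumes "u \<in> P" "u' \<in> P" shows "\<exists>p\<in>P. below p u \<and> below p u'"
  using connected[OF assms]
proof (induction rule: equivclp_induct)
  case base then show ?case using assms below_refl by blast
next
  case (step y z)
  then obtain p where p: "p \<in> P" "below p u" "below p y" by blast
  from step(2) show ?case
  proof
    assume "step y z"
    then obtain v where v: "v \<in> V" "z = y \<cdot> v" "y \<in> P" by (auto simp: step_def)
    have "below (p \<cdot> v) u" using below_trans below_prod p P_U V_U v by blast
    moreover have "below (p \<cdot> v) z"
      using p(1,3) v P_U V_U unfolding below_def by (auto simp: H1_prod)
    ultimately show ?thesis using prod_P p(1) v(1) by blast
  next
    assume "step z y"
    then obtain v where v: "v \<in> V" "y = z \<cdot> v" "z \<in> P" by (auto simp: step_def)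
    then show ?thesis using p below_trans below_prod P_U V_U by blast
  qed
qed

lemma lower_bound:
  assumes "finite T" "T \<subseteq> P" "q \<in> P" shows "\<exists>p\<in>P. below p q \<and> (\<forall>t\<in>T. below p t)"
  using assms(1,2)
proof (induction T rule: finite_induct)
  case empty then show ?case using assms(3) below_refl by auto
next
  case (insert t T)
  then obtain p where p: "p \<in> P" "below p q" "\<forall>t\<in>T. below p t" by auto
  obtain p' where "p' \<in> P" "below p' p" "below p' t" using common_lower_bound[of p t] p insert.prems by auto
  then show ?case using p below_trans by blast
qed

lemma lower_bound_letters:
  assumes "finite T" "T \<subseteq> V" "q \<in> P"
  shows "\<exists>p\<in>P. below p q \<and> (\<forall>v\<in>T. \<forall>x\<in>H1. is_state (x p) \<longrightarrow> is_letter (x v))"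
  using assms(1,2)
proof (induction T rule: finite_induct)
  case empty then show ?case using assms(3) below_refl by auto
next
  case (insert v T)
  then obtain p where p: "p \<in> P" "below p q" "\<forall>v\<in>T. \<forall>x\<in>H1. is_state (x p) \<longrightarrow> is_letter (x v)" by auto
  have v: "v \<in> V" using insert.prems by simp
  have "p \<cdot> v \<in> P" "below (p \<cdot> v) q"
    by (rule prod_P[OF p(1) v]) (rule below_prod_trans[OF p(1) v p(2)])
  moreover have "\<forall>v'\<in>insert v T. \<forall>x\<in>H1. is_state (x (p \<cdot> v)) \<longrightarrow> is_letter (x v')"
    using p(3) H1_prod P_U[OF p(1)] V_U[OF v] by simp
  ultimately show ?case by (intro bexI conjI)
qed

text \<open>The desired evaluation point may be sought below \<open>p\<close>: there \<open>f\<close> is a state whenever the point is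
  sent to a state.\<close>

lemma bottom: "\<exists>p\<in>P. \<forall>x\<in>H1. is_state (x p) \<longrightarrow> is_state (f x)"
proof -
  obtain q where "q \<in> P" using local_P[of "{}"] by auto
  then obtain p where p: "p \<in> P" "\<forall>t\<in>F \<inter> P. below p t"
    using lower_bound[of "F \<inter> P" q] F(1) by auto
  then obtain p' where p': "p' \<in> P" "below p' p"
    "\<forall>v\<in>F \<inter> V. \<forall>x\<in>H1. is_state (x p') \<longrightarrow> is_letter (x v)"
    using lower_bound_letters[of "F \<inter> V" p] F(1) by auto
  have "is_state (f x)" if x: "x \<in> H1" "is_state (x p')" for x
  proof (rule state_if_on_F[OF x(1)])
    have "below p' t" if "t \<in> F \<inter> P" for t using below_trans p(2) p'(2) that by blast
    then show "is_state (x u)" if "u \<in> F \<inter> P" for u using that x by (auto simp: below_def)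
    show "is_letter (x v)" if "v \<in> F \<inter> V" for v using that x p'(3) by blast
  qed
  then show ?thesis using p'(1) by blast
qed

text \<open>The homomorphisms into block \<open>b\<close> with the support of \<open>x0\<close>. They form a vector space over the field of
  residues, since every residue is a letter of block \<open>b\<close> (\<open>make_K0\<close>).\<close>

definition K0 :: "nat \<Rightarrow> ('b \<Rightarrow> nat) set" where
  "K0 b = {x \<in> H. \<forall>u\<in>U. (is_state (x u) \<longleftrightarrow> u \<in> P) \<and> (is_letter (x u) \<longleftrightarrow> u \<in> V) \<and>
     (x u \<noteq> 0 \<longrightarrow> block (x u) = b)}"

lemma K0_H: "x \<in> K0 b \<Longrightarrow> x \<in> H"
  by (auto simp: K0_def)

lemma K0_state:
  assumes "x \<in> K0 b" "u \<in> P" shows "is_state (x u)" "block (x u) = b" "val (x u) < modulus b"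
proof -
  show st: "is_state (x u)" "block (x u) = b" using assms P_U nonzero by (auto simp: K0_def)
  then show "val (x u) < modulus b" using hom_val[of x u] assms P_U K0_H nonzero by auto
qed

lemma K0_letter:
  assumes "x \<in> K0 b" "v \<in> V" shows "is_letter (x v)" "block (x v) = b" "val (x v) < modulus b"
proof -
  show st: "is_letter (x v)" "block (x v) = b" using assms V_U nonzero by (auto simp: K0_def)
  then show "val (x v) < modulus b" using hom_val[of x v] assms V_U K0_H nonzero by auto
qed

lemma K0_eq_0: "x \<in> K0 b \<Longrightarrow> u \<in> U \<Longrightarrow> u \<notin> P \<Longrightarrow> u \<notin> V \<Longrightarrow> x u = 0"
  using state_or_letter(1) by (auto simp: K0_def)

definition ev :: "('b \<Rightarrow> nat) \<Rightarrow> 'b \<Rightarrow> int" where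
  "ev x u = int (val (x u))"

lemma ev_prod:
  assumes "x \<in> K0 b" "u \<in> P" "v \<in> V"
  shows "[ev x (u \<cdot> v) = ev x u + ev x v] (mod int (modulus b))"
proof -
  have "is_state (act (x u) (x v))" using K0_state K0_letter assms by simp
  then have "val (x (u \<cdot> v)) = (val (x u) + val (x v)) mod modulus b"
    using hom_prod[OF K0_H, of x b u v] assms P_U V_U val_act K0_state by simp
  then show ?thesis by (simp add: ev_def cong_def zmod_int)
qed

definition make :: "nat \<Rightarrow> ('b \<Rightarrow> int) \<Rightarrow> 'b \<Rightarrow> nat" where
  "make b s = (\<lambda>u\<in>U. if u \<in> P then state b (nat (s u mod int (modulus b)))
     else if u \<in> V then letter b (nat (s u mod int (modulus b))) else 0)"

lemma ev_make: "u \<in> P \<union> V \<Longrightarrow> ev (make b s) u = s u mod int (modulus b)"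
  using P_U V_U by (auto simp: ev_def make_def)

lemma make_K0:
  assumes b: "b < c" and s: "\<And>u v. u \<in> P \<Longrightarrow> v \<in> V \<Longrightarrow> [s (u \<cdot> v) = s u + s v] (mod int (modulus b))"
  shows "make b s \<in> K0 b"
proof -
  have lt: "nat (s u mod int (modulus b)) < modulus b" for u
    using modulus_pos[of b] by (simp add: nat_less_iff)
  have range: "make b s u \<in> universe (cyclic_blocks c c)" if "u \<in> U" for u
    using that b lt by (simp add: make_def)
  have kind: "(is_state (make b s u) \<longleftrightarrow> u \<in> P) \<and> (is_letter (make b s u) \<longleftrightarrow> u \<in> V) \<and>
     (make b s u \<noteq> 0 \<longrightarrow> block (make b s u) = b)" if "u \<in> U" for u
    using that P_V_disjoint by (simp add: make_def)
  have "make b s (u \<cdot> v) = act (make b s u) (make b s v)" if uv: "u \<in> U" "v \<in> U" for u v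
  proof (cases "u \<in> P \<and> v \<in> V")
    case True
    then have P: "u \<cdot> v \<in> P" "u \<in> P" "v \<in> V" "v \<notin> P" using prod_P P_V_disjoint by auto
    have "int ((nat (s u mod int (modulus b)) + nat (s v mod int (modulus b))) mod modulus b)
        = (s u mod int (modulus b) + s v mod int (modulus b)) mod int (modulus b)"
      by (simp add: zmod_int)
    also have "\<dots> = s (u \<cdot> v) mod int (modulus b)" using s[OF P(2,3)] by (simp add: cong_def mod_add_eq)
    finally have "(nat (s u mod int (modulus b)) + nat (s v mod int (modulus b))) mod modulus b
        = nat (s (u \<cdot> v) mod int (modulus b))" by linarith
    then show ?thesis using P uv by (simp add: make_def act_def)
  next
    case False
    then have "make b s (u \<cdot> v) = 0" using prod_P_iff[OF uv] prod_not_V[OF uv] uv by (simp add: make_def)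
    moreover have "act (make b s u) (make b s v) = 0"
      using kind[OF uv(1)] kind[OF uv(2)] False by (auto simp: act_eq_0)
    ultimately show ?thesis by simp
  qed
  moreover have "make b s \<in> U \<rightarrow>\<^sub>E universe (cyclic_blocks c c)"
    using range by (simp add: PiE_iff) (simp add: make_def)
  ultimately show ?thesis using kind by (simp add: K0_def homs_def)
qed

definition fv :: "('b \<Rightarrow> nat) \<Rightarrow> int" where
  "fv x = int (val (f x))"

lemma combination_on_K0:
  assumes b: "b < c"
  shows "\<exists>k. \<forall>x\<in>K0 b. [fv x = (\<Sum>i\<in>F \<inter> (P \<union> V). k i * ev x i)] (mod int (modulus b))"
proof (rule functional_combination)
  show "prime (int (modulus b))" using prime_modulus by simp
  show "finite (F \<inter> (P \<union> V))" using F(1) by simp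
next
  fix x y n assume xy: "x \<in> K0 b" "y \<in> K0 b"
  define z where "z = make b (\<lambda>u. ev x u + n * ev y u)"
  have z: "z \<in> K0 b" unfolding z_def
  proof (rule make_K0[OF b])
    fix u v assume uv: "u \<in> P" "v \<in> V"
    have "[ev x (u \<cdot> v) + n * ev y (u \<cdot> v) = (ev x u + ev x v) + n * (ev y u + ev y v)] (mod int (modulus b))"
      using ev_prod uv xy by (intro cong_add cong_mult cong_refl) auto
    then show "[ev x (u \<cdot> v) + n * ev y (u \<cdot> v) = ev x u + n * ev y u + (ev x v + n * ev y v)] (mod int (modulus b))"
      by (simp add: algebra_simps)
  qed
  have zv: "[ev z i = ev x i + n * ev y i] (mod int (modulus b))" if "i \<in> P \<union> V" for i
    using ev_make[OF that] by (simp add: z_def)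
  obtain a where a: "a \<in> P" "f x = x a" "f y = y a" "f z = z a"
    using local_P[of "{x, y, z}"] xy z K0_H by auto
  then have "[fv z = fv x + n * fv y] (mod int (modulus b))"
    using zv[of a] by (simp add: fv_def ev_def)
  then show "\<exists>z\<in>K0 b. (\<forall>i\<in>F \<inter> (P \<union> V). [ev z i = ev x i + n * ev y i] (mod int (modulus b))) \<and>
      [fv z = fv x + n * fv y] (mod int (modulus b))"
    using z zv by blast
next
  fix x assume x: "x \<in> K0 b" and 0: "\<forall>i\<in>F \<inter> (P \<union> V). [ev x i = 0] (mod int (modulus b))"
  define z where "z = make b (\<lambda>_. 0)"
  have z: "z \<in> K0 b" unfolding z_def by (rule make_K0[OF b]) simp
  have "f x = f z"
  proof (rule support)
    show "x \<in> H" "z \<in> H" using x z K0_H by auto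
    fix u assume u: "u \<in> F"
    then have uU: "u \<in> U" using F(2) by auto
    have v0: "val (x u) = 0" if "u \<in> P \<union> V"
    proof -
      have "val (x u) < modulus b" using that K0_state(3)[OF x] K0_letter(3)[OF x] by blast
      moreover have "[ev x u = 0] (mod int (modulus b))" using 0 u that by blast
      ultimately show ?thesis by (simp add: ev_def cong_def zmod_int[symmetric])
    qed
    consider "u \<in> P" | "u \<in> V" | "u \<notin> P" "u \<notin> V" by blast
    then show "x u = z u"
    proof cases
      case 1
      then have "x u = state b 0" using K0_state[OF x 1] state_block_val[of "x u"] v0 by simp
      then show ?thesis using 1 uU by (simp add: z_def make_def)
    next
      case 2
      then have "x u = letter b 0" using K0_letter[OF x 2] letter_block_val[of "x u"] v0 by simp
      then show ?thesis using 2 uU P_V_disjoint[of u] by (auto simp: z_def make_def)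
    next
      case 3
      then show ?thesis using K0_eq_0 x z uU by metis
    qed
  qed
  moreover obtain a where "a \<in> P" "f z = z a" using local_P_single[OF K0_H[OF z]] by blast
  ultimately show "[fv x = 0] (mod int (modulus b))"
    using ev_make[of a b "\<lambda>_. 0"] by (simp add: fv_def ev_def z_def)
qed

definition gap :: "'b \<Rightarrow> ('b \<Rightarrow> nat) \<Rightarrow> 'b \<Rightarrow> int" where
  "gap p x i = (if i \<in> P then ev x i - ev x p else ev x i)"

text \<open>Shifting all states by \<open>1\<close> and no letter is a homomorphism on which \<open>f\<close> has the value \<open>1\<close>. Hence the
  coefficients at elements of \<open>P\<close> add up to \<open>1\<close>, and the combination can be rewritten in terms of
  differences to a base point \<open>p\<close>.\<close>

lemma affine_combination_on_K0:
  assumes b: "b < c" and p: "p \<in> P"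
  shows "\<exists>k. \<forall>x\<in>K0 b. [fv x = ev x p + (\<Sum>i\<in>F \<inter> (P \<union> V). k i * gap p x i)] (mod int (modulus b))"
proof -
  let ?S = "F \<inter> (P \<union> V)" and ?m = "int (modulus b)"
  obtain k where k: "\<forall>x\<in>K0 b. [fv x = (\<Sum>i\<in>?S. k i * ev x i)] (mod ?m)"
    using combination_on_K0[OF b] by blast
  \<comment> \<open>The shift of all states.\<close>
  define y where "y = make b (\<lambda>u. if u \<in> P then 1 else 0)"
  have y: "y \<in> K0 b" unfolding y_def
    using prod_P P_V_disjoint by (intro make_K0[OF b]) auto
  have m1: "1 mod ?m = 1" using modulus_ge_5[of b] by simp
  have yv: "ev y i = (if i \<in> P then 1 else 0)" if "i \<in> P \<union> V" for i
    using ev_make[OF that] m1 by (simp add: y_def)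
  obtain a where "a \<in> P" "f y = y a" using local_P_single[OF K0_H[OF y]] by blast
  then have "fv y = 1" using yv[of a] by (simp add: fv_def ev_def)
  moreover have "(\<Sum>i\<in>?S. k i * ev y i) = (\<Sum>i\<in>?S. k i * (if i \<in> P then 1 else 0))"
    using yv by (intro sum.cong) auto
  ultimately have one: "[1 = (\<Sum>i\<in>?S. k i * (if i \<in> P then 1 else 0))] (mod ?m)"
    using k y by metis
  have "[fv x = ev x p + (\<Sum>i\<in>?S. k i * gap p x i)] (mod ?m)" if x: "x \<in> K0 b" for x
  proof -
    have "(\<Sum>i\<in>?S. k i * gap p x i) = (\<Sum>i\<in>?S. k i * ev x i - ev x p * (k i * (if i \<in> P then 1 else 0)))"
      by (intro sum.cong) (auto simp: gap_def algebra_simps)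
    also have "\<dots> = (\<Sum>i\<in>?S. k i * ev x i) - ev x p * (\<Sum>i\<in>?S. k i * (if i \<in> P then 1 else 0))"
      by (simp only: sum_subtractf sum_distrib_left)
    finally have "ev x p + (\<Sum>i\<in>?S. k i * gap p x i) = ev x p + ((\<Sum>i\<in>?S. k i * ev x i)
        - ev x p * (\<Sum>i\<in>?S. k i * (if i \<in> P then 1 else 0)))" by simp
    also have "[\<dots> = ev x p + (fv x - ev x p * 1)] (mod ?m)"
      using k x one by (intro cong_add cong_diff cong_mult cong_refl) (auto intro: cong_sym)
    finally show ?thesis by (simp add: cong_sym)
  qed
  then show ?thesis by blast
qed

text \<open>Coefficients for different blocks matter only modulo different primes.\<close>

lemma uniform_combination:
  assumes p: "p \<in> P"
  shows "\<exists>n :: 'b \<Rightarrow> nat. \<forall>b<c. \<forall>x\<in>K0 b.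
    [fv x = ev x p + (\<Sum>i\<in>F \<inter> (P \<union> V). int (n i) * gap p x i)] (mod int (modulus b))"
proof -
  let ?S = "F \<inter> (P \<union> V)"
  have "\<forall>b. \<exists>k. b < c \<longrightarrow> (\<forall>x\<in>K0 b. [fv x = ev x p + (\<Sum>i\<in>?S. k i * gap p x i)] (mod int (modulus b)))"
    using affine_combination_on_K0[OF _ p] by blast
  then obtain k where k: "\<And>b x. b < c \<Longrightarrow> x \<in> K0 b \<Longrightarrow>
      [fv x = ev x p + (\<Sum>i\<in>?S. k b i * gap p x i)] (mod int (modulus b))" by metis
  have "\<exists>n. \<forall>b\<in>{..<c}. [n = nat (k b i mod int (modulus b))] (mod modulus b)" for i
    using coprime_modulus by (intro chinese_remainder_nat) auto
  then obtain n where n: "\<And>i b. b < c \<Longrightarrow> [n i = nat (k b i mod int (modulus b))] (mod modulus b)"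
    by (metis lessThan_iff)
  have nk: "[int (n i) = k b i] (mod int (modulus b))" if "b < c" for i b
    using n[OF that, of i] by (simp flip: cong_int_iff)
  have "[fv x = ev x p + (\<Sum>i\<in>?S. int (n i) * gap p x i)] (mod int (modulus b))"
    if "b < c" "x \<in> K0 b" for b x
  proof -
    have "[ev x p + (\<Sum>i\<in>?S. k b i * gap p x i) = ev x p + (\<Sum>i\<in>?S. int (n i) * gap p x i)] (mod int (modulus b))"
      using nk[OF that(1)] by (intro cong_add cong_sum cong_mult cong_refl) (auto intro: cong_sym)
    then show ?thesis using k[OF that] cong_trans by blast
  qed
  then show ?thesis by blast
qed

text \<open>The functions \<open>g\<close> by which the value at \<open>p\<close> can be changed by passing to an element below \<open>p\<close>.\<close>

definition reach :: "'b \<Rightarrow> (('b \<Rightarrow> nat) \<Rightarrow> int) \<Rightarrow> bool" where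
  "reach p g \<longleftrightarrow> (\<exists>d\<in>P. below d p \<and> (\<forall>b<c. \<forall>x\<in>K0 b. [ev x d = ev x p + g x] (mod int (modulus b))))"

lemma reach_cong:
  assumes "reach p g" "\<And>b x. b < c \<Longrightarrow> x \<in> K0 b \<Longrightarrow> [g x = g' x] (mod int (modulus b))"
  shows "reach p g'"
  using assms unfolding reach_def by (meson cong_add_lcancel cong_trans)

lemma reach_letter:
  assumes "reach p g" "v \<in> V" shows "reach p (\<lambda>x. g x + int n * ev x v)"
proof (induction n)
  case 0 then show ?case using assms by simp
next
  case (Suc n)
  then obtain d where d: "d \<in> P" "below d p"
    "\<And>b x. b < c \<Longrightarrow> x \<in> K0 b \<Longrightarrow> [ev x d = ev x p + (g x + int n * ev x v)] (mod int (modulus b))"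
    unfolding reach_def by blast
  have "d \<cdot> v \<in> P" "below (d \<cdot> v) p"
    by (rule prod_P[OF d(1) assms(2)]) (rule below_prod_trans[OF d(1) assms(2) d(2)])
  moreover have "[ev x (d \<cdot> v) = ev x p + (g x + int (Suc n) * ev x v)] (mod int (modulus b))"
    if "b < c" "x \<in> K0 b" for b x
  proof -
    have "[ev x (d \<cdot> v) = ev x d + ev x v] (mod int (modulus b))" using ev_prod that d(1) assms(2) by blast
    also have "[ev x d + ev x v = ev x p + (g x + int n * ev x v) + ev x v] (mod int (modulus b))"
      using d(3)[OF that] by (intro cong_add cong_refl)
    finally show ?thesis by (simp add: algebra_simps)
  qed
  ultimately show ?case unfolding reach_def by blast
qed

text \<open>Along a path in \<open>P\<close> each step adds or removes a letter. Removing it amounts to multiplying by it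
  once less than the product of all moduli.\<close>

lemma reach_difference:
  assumes "u \<in> P" "u' \<in> P" "reach p g" shows "reach p (\<lambda>x. g x + (ev x u' - ev x u))"
  using connected[OF assms(1,2)]
proof (induction rule: equivclp_induct)
  case base then show ?case using assms(3) by simp
next
  case (step y z)
  from step(2) show ?case
  proof
    assume "step y z"
    then obtain v where v: "v \<in> V" "z = y \<cdot> v" "y \<in> P" by (auto simp: step_def)
    show ?thesis
    proof (rule reach_cong[OF reach_letter[OF step(3) v(1), of 1]])
      fix b x assume "b < c" "x \<in> K0 b"
      then have "[g x + (ev x z - ev x u) = g x + (ev x y + ev x v - ev x u)] (mod int (modulus b))"
        using ev_prod[of x b y v] v by (intro cong_add cong_diff cong_refl) auto
      then show "[g x + (ev x y - ev x u) + int 1 * ev x v = g x + (ev x z - ev x u)] (mod int (modulus b))"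
        by (simp add: algebra_simps cong_sym)
    qed
  next
    assume "step z y"
    then obtain v where v: "v \<in> V" "y = z \<cdot> v" "z \<in> P" by (auto simp: step_def)
    define M where "M = (\<Prod>b<c. modulus b)"
    have M: "M > 0" by (simp add: M_def)
    show ?thesis
    proof (rule reach_cong[OF reach_letter[OF step(3) v(1), of "M - 1"]])
      fix b x assume b: "b < c" "x \<in> K0 b"
      have "modulus b dvd M" unfolding M_def using b(1) by (intro dvd_prodI) auto
      then have M0: "[int M * ev x v = 0] (mod int (modulus b))" by (simp add: cong_0_iff)
      have "[g x + (ev x y - ev x u) + int (M - 1) * ev x v
          = g x + ((ev x z + ev x v) - ev x u) + int (M - 1) * ev x v] (mod int (modulus b))"
        using ev_prod[of x b z v] v b by (intro cong_add cong_diff cong_refl) auto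
      also have "g x + ((ev x z + ev x v) - ev x u) + int (M - 1) * ev x v
          = g x + (ev x z - ev x u) + int M * ev x v"
        using M by (simp add: of_nat_diff algebra_simps)
      also have "[g x + (ev x z - ev x u) + int M * ev x v = g x + (ev x z - ev x u) + 0] (mod int (modulus b))"
        by (intro cong_add cong_refl M0)
      finally show "[g x + (ev x y - ev x u) + int (M - 1) * ev x v = g x + (ev x z - ev x u)] (mod int (modulus b))"
        by simp
    qed
  qed
qed

lemma reach_gap:
  assumes "p \<in> P" "i \<in> P \<union> V" "reach p g" shows "reach p (\<lambda>x. g x + int n * gap p x i)"
proof (cases "i \<in> P")
  case True
  show ?thesis
  proof (induction n)
    case 0 then show ?case using assms(3) by simp
  next
    case (Suc n)
    have "reach p (\<lambda>x. g x + int n * gap p x i + (ev x i - ev x p))"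
      by (rule reach_difference[OF assms(1) True Suc])
    then show ?case using True by (simp add: gap_def algebra_simps)
  qed
next
  case False
  then show ?thesis using reach_letter[OF assms(3), of i n] assms(2) by (simp add: gap_def)
qed

lemma reach_combination:
  assumes "p \<in> P" "finite T" "T \<subseteq> P \<union> V"
  shows "reach p (\<lambda>x. \<Sum>i\<in>T. int (n i) * gap p x i)"
  using assms(2,3)
proof (induction T rule: finite_induct)
  case empty
  show ?case unfolding reach_def using assms(1) below_refl by (intro bexI[of _ p]) auto
next
  case (insert i T)
  then have "reach p (\<lambda>x. (\<Sum>i\<in>T. int (n i) * gap p x i) + int (n i) * gap p x i)"
    using assms(1) by (intro reach_gap) auto
  then show ?case using insert.hyps by (simp add: add.commute)
qed

lemma value_on_K0:
  assumes "p \<in> P"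
  shows "\<exists>d\<in>P. below d p \<and> (\<forall>b<c. \<forall>x\<in>K0 b. f x = x d)"
proof -
  obtain n where n: "\<And>b x. b < c \<Longrightarrow> x \<in> K0 b \<Longrightarrow>
    [fv x = ev x p + (\<Sum>i\<in>F \<inter> (P \<union> V). int (n i) * gap p x i)] (mod int (modulus b))"
    using uniform_combination[OF assms] by blast
  obtain d where d: "d \<in> P" "below d p" "\<And>b x. b < c \<Longrightarrow> x \<in> K0 b \<Longrightarrow>
    [ev x d = ev x p + (\<Sum>i\<in>F \<inter> (P \<union> V). int (n i) * gap p x i)] (mod int (modulus b))"
    using reach_combination[OF assms, of "F \<inter> (P \<union> V)" n] F(1) unfolding reach_def by auto
  have "f x = x d" if b: "b < c" "x \<in> K0 b" for b x
  proof -
    obtain a where a: "a \<in> P" "f x = x a" using local_P_single[OF K0_H[OF b(2)]] by blast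
    have "[fv x = ev x d] (mod int (modulus b))" using n[OF b] d(3)[OF b] cong_trans cong_sym by blast
    then have "[val (x a) = val (x d)] (mod modulus b)" using a(2) by (simp add: fv_def ev_def cong_int_iff)
    then have "val (x a) = val (x d)" using K0_state(3)[OF b(2)] a(1) d(1) by (simp add: cong_def)
    then have "x a = x d"
      using K0_state(1,2)[OF b(2) a(1)] K0_state(1,2)[OF b(2) d(1)] state_block_val by metis
    then show ?thesis using a(2) by simp
  qed
  then show ?thesis using d by blast
qed

text \<open>Products are never sent to letters, and multiplying with a letter as often as the product of all moduli
  says does not change any value on \<open>K0\<close>. If there is no letter to multiply with, \<open>P\<close> is a single point,
  at which \<open>f\<close> is an evaluation anyway.\<close>

lemma value_on_K0_not_letter:
  assumes p: "p \<in> P"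
  shows "\<exists>d\<in>P. below d p \<and> (\<forall>b<c. \<forall>x\<in>K0 b. f x = x d) \<and> (\<forall>x\<in>H. \<not> is_letter (x d))"
proof -
  obtain d where d: "d \<in> P" "below d p" "\<And>b x. b < c \<Longrightarrow> x \<in> K0 b \<Longrightarrow> f x = x d"
    using value_on_K0[OF p] by blast
  show ?thesis
  proof (cases "V = {}")
    case True
    then have no_step: "\<not> step u u'" for u u' by (simp add: step_def)
    have "u = d" if "u \<in> P" for u
      using connected[OF d(1) that] by (induction rule: equivclp_induct) (simp_all add: no_step)
    then have "f x = x d" if "x \<in> H" for x using local_P_single[OF that] by metis
    then show ?thesis using d no_letter by metis
  next
    case False
    then obtain v where v: "v \<in> V" by blast
    define M where "M = (\<Prod>b<c. modulus b)"
    have M: "M > 0" by (simp add: M_def)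
    define w where "w = (\<lambda>n. ((\<lambda>u. u \<cdot> v) ^^ n) d)"
    have w: "w n \<in> P \<and> below (w n) d \<and> (\<forall>b<c. \<forall>x\<in>K0 b. [ev x (w n) = ev x d + int n * ev x v] (mod int (modulus b)))" for n
    proof (induction n)
      case 0 then show ?case using d(1) below_refl by (simp add: w_def)
    next
      case (Suc n)
      have "w (Suc n) = w n \<cdot> v" by (simp add: w_def)
      moreover have "w n \<cdot> v \<in> P" "below (w n \<cdot> v) d"
        using prod_P[of "w n" v] below_prod_trans[of "w n" v d] Suc v by auto
      moreover have "[ev x (w n \<cdot> v) = ev x d + int (Suc n) * ev x v] (mod int (modulus b))"
        if "b < c" "x \<in> K0 b" for b x
      proof -
        have "[ev x (w n \<cdot> v) = ev x (w n) + ev x v] (mod int (modulus b))" using ev_prod that Suc v by blast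
        also have "[ev x (w n) + ev x v = ev x d + int n * ev x v + ev x v] (mod int (modulus b))"
          using Suc that by (intro cong_add cong_refl) blast
        finally show ?thesis by (simp add: algebra_simps)
      qed
      ultimately show ?case by auto
    qed
    have "f x = x (w M)" if b: "b < c" "x \<in> K0 b" for b x
    proof -
      have "modulus b dvd M" unfolding M_def using b(1) by (intro dvd_prodI) auto
      then have "[ev x d + int M * ev x v = ev x d + 0] (mod int (modulus b))"
        by (intro cong_add cong_refl) (simp add: cong_0_iff)
      then have "[ev x (w M) = ev x d] (mod int (modulus b))" using w b cong_trans by (metis add.right_neutral)
      then have "[val (x (w M)) = val (x d)] (mod modulus b)" by (simp add: ev_def cong_int_iff)
      then have "val (x (w M)) = val (x d)" using K0_state(3)[OF b(2)] w d(1) by (simp add: cong_def)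
      then have "x (w M) = x d"
        using K0_state(1,2)[OF b(2), of "w M"] K0_state(1,2)[OF b(2) d(1)] w state_block_val by metis
      then show ?thesis using d(3)[OF b] by simp
    qed
    moreover have "\<not> is_letter (x (w M))" if "x \<in> H" for x
    proof -
      have "w M = w (M - 1) \<cdot> v" using M by (cases M) (auto simp: w_def)
      then show ?thesis using not_letter_prod[OF that] w P_U V_U v by simp
    qed
    ultimately show ?thesis using w below_trans d(2) by blast
  qed
qed

text \<open>For homomorphisms into one block, the value of \<open>f\<close> is found by cutting down to the support of \<open>x0\<close>;
  any other homomorphism is composed of its parts in the blocks.\<close>

lemma evaluation_state_case: "evaluation A (cyclic_blocks c c) f"
proof -
  obtain p where p: "p \<in> P" "\<And>x. x \<in> H1 \<Longrightarrow> is_state (x p) \<Longrightarrow> is_state (f x)"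
    using bottom by blast
  obtain d where d: "d \<in> P" "below d p" "\<And>b x. b < c \<Longrightarrow> x \<in> K0 b \<Longrightarrow> f x = x d"
      "\<And>x. x \<in> H \<Longrightarrow> \<not> is_letter (x d)"
    using value_on_K0_not_letter[OF p(1)] by blast
  have dU: "d \<in> U" using d(1) P_U by blast
  have 1: "f x = x d" if x: "x \<in> H1" for x
  proof (cases "is_state (f x)")
    case True
    \<comment> \<open>This has the support of \<open>x0\<close>, so the value at \<open>d\<close> is known there.\<close>
    define y where "y = cut x (P \<union> V)"
    have y: "y \<in> H1" unfolding y_def
    proof (rule cut_H1[OF x])
      fix u v assume uv: "u \<in> U" "v \<in> U" "is_state (x u)" "is_letter (x v)"
      then have "u \<notin> V" "v \<notin> P" using letter_on_V[OF x True] state_on_P[OF x True] state_not_letter by blast+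
      then show "u \<cdot> v \<in> P \<union> V \<longleftrightarrow> u \<in> P \<union> V \<and> v \<in> P \<union> V"
        using prod_P_iff[OF uv(1,2)] prod_not_V[OF uv(1,2)] by auto
    qed
    obtain b where b: "\<And>u. u \<in> U \<Longrightarrow> x u \<noteq> 0 \<Longrightarrow> block (x u) = b" using x by (auto simp: H1_def)
    have "y \<in> K0 b"
      unfolding K0_def using H1_hom[OF y] state_on_P[OF x True] letter_on_V[OF x True] b P_V_disjoint
      by (auto simp: y_def dest: state_not_letter)
    moreover have "x d \<noteq> 0" using state_on_P[OF x True d(1)] nonzero by blast
    then have "b < c" using b[OF dU] hom_val[OF H1_hom[OF x] dU] by simp
    ultimately have "f y = y d" using d(3) by blast
    moreover obtain a where "a \<in> P" "f x = x a" "f y = y a"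
      using local_P_pair H1_hom x y by blast
    ultimately show ?thesis using d(1) P_U by (simp add: y_def)
  next
    case False
    then have "f x = 0" using no_letter[OF H1_hom[OF x]] state_or_letter(1) by blast
    moreover have "\<not> is_state (x d)" using False p(2)[OF x] d(2) x by (auto simp: below_def)
    then have "x d = 0" using d(4)[OF H1_hom[OF x]] state_or_letter(1) by blast
    ultimately show ?thesis by simp
  qed
  have "f x = x d" if x: "x \<in> H" for x
  proof -
    define y where "y = (\<lambda>b. cut x {u. block (x u) = b})"
    have y: "y b \<in> H1" for b unfolding y_def by (rule cut_block[OF x])
    have yd: "f (y b) = (if block (x d) = b then x d else 0)" for b using 1[OF y] dU by (simp add: y_def)
    obtain a where a: "a \<in> P" "f x = x a" "\<forall>b<c. f (y b) = y b a"
      using local_P[of "insert x (y ` {..<c})"] x H1_hom[OF y] by (auto simp: image_subset_iff)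
    have aU: "a \<in> U" using a(1) P_U by blast
    have eq: "(if block (x a) = b then x a else 0) = (if block (x d) = b then x d else 0)" if "b < c" for b
      using a(3) that yd aU by (simp add: y_def)
    show ?thesis
    proof (cases "x a = 0")
      case True
      then have "x d = 0" using eq[of "block (x d)"] hom_val[OF x dU] by metis
      then show ?thesis using True a(2) by simp
    next
      case False
      then show ?thesis using eq[of "block (x a)"] hom_val[OF x aU] a(2) by metis
    qed
  qed
  then show ?thesis using dU by (auto simp: evaluation_def)
qed

end

section \<open>Complete blocks are dualizable\<close>

theorem (in local_evaluation) evaluation_if_local: "evaluation A (cyclic_blocks c c) f"
proof (cases "\<exists>x\<in>H. is_letter (f x)")
  case True then show ?thesis using evaluation_if_letter by blast
next
  case no_letter: False
  show ?thesis
  proof (cases "\<exists>x\<in>H. is_state (f x)")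
    case True
    then obtain x0 where "x0 \<in> H1" "is_state (f x0)"
      "\<forall>y\<in>H1. is_state (f y) \<longrightarrow> (\<forall>u\<in>U. x0 u \<noteq> 0 \<longrightarrow> same_kind (y u) (x0 u))"
      using least_state_hom by blast
    then interpret least_state_evaluation c A f F x0
      using no_letter by unfold_locales auto
    show ?thesis by (rule evaluation_state_case)
  next
    case False
    then show ?thesis using no_letter evaluation_if_zero state_or_letter(1) by blast
  qed
qed

text \<open>The tuples of values that the members of \<open>X\<close> take at the elements of the algebra form a compatible
  relation, and \<open>f\<close> preserves it.\<close>

lemma local_evaluation_if_preserves:
  assumes A: "binary_algebra A" and M: "binary_algebra M"
    and pres: "\<And>k r. compatible M k r \<Longrightarrow> preserves A M f k r"
    and X: "finite X" "X \<subseteq> homs A M"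
  shows "\<exists>a\<in>universe A. \<forall>x\<in>X. f x = x a"
proof (cases "X = {}")
  case True then show ?thesis using A by (auto simp: binary_algebra_def)
next
  case False
  obtain xs where xs: "X = set xs" using finite_list[OF X(1)] by blast
  define k where "k = length xs"
  have k: "k \<ge> 1" using False xs by (cases xs) (auto simp: k_def)
  have hom: "xs ! i \<in> homs A M" if "i < k" for i using that X(2) xs by (auto simp: k_def)
  define r where "r = (\<lambda>a. \<lambda>i\<in>{..<k}. (xs ! i) a) ` universe A"
  have mA: "mul A a b \<in> universe A" if "a \<in> universe A" "b \<in> universe A" for a b
    using A that by (simp add: binary_algebra_def subuniverse_def)
  have "(xs ! i) a \<in> universe M" if "i < k" "a \<in> universe A" for i a
    using hom[OF that(1)] that(2) by (auto simp: homs_def)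
  then have "r \<subseteq> universe (power_alg M {..<k})"
    unfolding r_def power_alg_def by (simp add: image_subset_iff)
  moreover have "mul (power_alg M {..<k}) y z \<in> r" if yz: "y \<in> r" "z \<in> r" for y z
  proof -
    obtain a b where ab: "a \<in> universe A" "b \<in> universe A" "y = (\<lambda>i\<in>{..<k}. (xs ! i) a)"
      "z = (\<lambda>i\<in>{..<k}. (xs ! i) b)" using yz by (auto simp: r_def)
    have "mul (power_alg M {..<k}) y z = (\<lambda>i\<in>{..<k}. (xs ! i) (mul A a b))"
      using ab hom by (auto simp: power_alg_def homs_def)
    then show ?thesis using mA ab by (auto simp: r_def)
  qed
  ultimately have "compatible M k r" using k by (simp add: compatible_def subuniverse_def)
  then have "preserves A M f k r" by (rule pres)
  then have "(\<lambda>i\<in>{..<k}. f (xs ! i)) \<in> r"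
    using hom unfolding preserves_def by (auto simp: r_def)
  then obtain a where a: "a \<in> universe A" "(\<lambda>i\<in>{..<k}. f (xs ! i)) = (\<lambda>i\<in>{..<k}. (xs ! i) a)"
    unfolding r_def by (elim imageE)
  have "f x = x a" if "x \<in> X" for x
  proof -
    have "x \<in> set xs" using that xs by simp
    then obtain i where "i < length xs" "xs ! i = x" unfolding in_set_conv_nth by blast
    then have i: "i < k" "x = xs ! i" by (simp_all add: k_def)
    have "f (xs ! i) = (xs ! i) a" using fun_cong[OF a(2), of i] i(1) by simp
    then show ?thesis unfolding i(2) .
  qed
  then show ?thesis using a(1) by blast
qed

theorem dualizable_complete_blocks: "dualizable TYPE('b) (cyclic_blocks c c)"
  unfolding dualizable_def
proof (intro allI impI, elim conjE)
  fix A :: "'b binalg" and f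
  assume ISP: "in_ISP (cyclic_blocks c c) A"
    and cont: "continuous_map (hom_space A (cyclic_blocks c c))
      (discrete_topology (universe (cyclic_blocks c c))) f"
    and pres: "\<forall>k r. compatible (cyclic_blocks c c) k r \<longrightarrow> preserves A (cyclic_blocks c c) f k r"
  have A: "binary_algebra A" using ISP by (simp add: in_ISP_def)
  obtain F where F: "finite F" "F \<subseteq> universe A" "\<forall>x\<in>homs A (cyclic_blocks c c).
      \<forall>y\<in>homs A (cyclic_blocks c c). (\<forall>a\<in>F. x a = y a) \<longrightarrow> f x = f y"
    using continuous_map_finite_support[OF A finite_cyclic_blocks cont] by blast
  interpret local_evaluation c A f F
  proof
    fix X assume X: "finite X" "X \<subseteq> homs A (cyclic_blocks c c)"
    show "\<exists>a\<in>universe A. \<forall>x\<in>X. f x = x a"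
      by (rule local_evaluation_if_preserves[OF A binary_algebra_cyclic_blocks _ X]) (simp add: pres)
  next
    fix x y assume "x \<in> homs A (cyclic_blocks c c)" "y \<in> homs A (cyclic_blocks c c)"
      "\<And>a. a \<in> F \<Longrightarrow> x a = y a"
    then show "f x = f y" using F(3) by blast
  qed (fact A F(1,2))+
  show "evaluation A (cyclic_blocks c c) f" by (rule evaluation_if_local)
qed

section \<open>Two letters on the last block\<close>

lemma one_exception:
  fixes \<theta> :: "nat \<Rightarrow> 'a"
  assumes "\<And>i j k l. distinct [i, j, k, l] \<Longrightarrow> \<theta> i = \<theta> j \<or> \<theta> k = \<theta> l"
  shows "\<exists>s j. \<forall>i. i \<noteq> j \<longrightarrow> \<theta> i = s"
proof (cases "\<exists>i j. \<theta> i \<noteq> \<theta> j")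
  case True
  then obtain i j where ij: "\<theta> i \<noteq> \<theta> j" by blast
  obtain k where k: "k \<notin> {i, j}" using ex_new_if_finite[of "{i, j}"] by auto
  obtain l where l: "l \<notin> {i, j, k}" using ex_new_if_finite[of "{i, j, k}"] by auto
  have s: "\<theta> k' = \<theta> k" if "k' \<notin> {i, j}" for k'
    using assms[of i j k' k] ij that k by (cases "k' = k") auto
  have "\<theta> i = \<theta> k \<or> \<theta> j = \<theta> l" using assms[of i k j l] ij k l by auto
  then consider "\<theta> i = \<theta> k" | "\<theta> j = \<theta> k" using s[of l] l by auto
  then show ?thesis
  proof cases
    case 1 then have "\<forall>i. i \<noteq> j \<longrightarrow> \<theta> i = \<theta> k" using s by (metis insertE singletonD)
    then show ?thesis by blast
  next
    case 2 then have "\<forall>j. j \<noteq> i \<longrightarrow> \<theta> j = \<theta> k" using s by (metis insertE singletonD)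
    then show ?thesis by blast
  qed
qed auto

lemma small_multiple:
  fixes z p :: int
  assumes "p dvd z" "\<bar>z\<bar> < p" shows "z = 0"
  using assms dvd_imp_le_int[of z p] by linarith

text \<open>For \<open>p \<ge> 5\<close> the residues \<open>-2\<close> and \<open>2\<close> differ from \<open>-1\<close>, \<open>0\<close> and \<open>1\<close>. This is the reason for
  excluding the smaller primes.\<close>

lemma signs_conflict:
  fixes p A B a b c d :: int
  assumes p: "5 \<le> p" and s: "\<bar>a\<bar> \<le> 1" "\<bar>b\<bar> \<le> 1" "\<bar>c\<bar> \<le> 1" "\<bar>d\<bar> \<le> 1"
    and A: "p dvd A - a" and B: "p dvd B - b" and AB: "p dvd A + B - c" "p dvd A - B - d"
  shows "p dvd A \<or> p dvd B"
proof -
  have "p dvd (A + B - c) - (A - a) - (B - b)" by (intro dvd_diff A B AB)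
  moreover have "p dvd (A - B - d) - (A - a) + (B - b)" by (intro dvd_add[OF dvd_diff] A B AB)
  ultimately have "p dvd a + b - c" "p dvd a - b - d" by (simp_all add: algebra_simps)
  moreover have "\<bar>a + b - c\<bar> < p" "\<bar>a - b - d\<bar> < p" using p s by linarith+
  ultimately have "a + b - c = 0" "a - b - d = 0" by (auto dest: small_multiple)
  then have "a = 0 \<or> b = 0" using s by linarith
  then show ?thesis using A B by auto
qed

text \<open>The blocks before \<open>n\<close> are complete and block \<open>n\<close> has two letters.\<close>

locale two_letter_block =
  fixes n :: nat
begin

abbreviation m where "m \<equiv> modulus n"

abbreviation M where "M \<equiv> cyclic_blocks n (Suc n)"

definition st :: "(nat \<Rightarrow> nat) \<Rightarrow> nat \<Rightarrow> nat" where
  "st v = (\<lambda>i. state n (v i))"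

definition lt :: "nat set \<Rightarrow> nat \<Rightarrow> nat" where
  "lt I = (\<lambda>i. letter n (of_bool (i \<in> I)))"

definition add_set :: "(nat \<Rightarrow> nat) \<Rightarrow> nat set \<Rightarrow> nat \<Rightarrow> nat" where
  "add_set v I = (\<lambda>i. (v i + of_bool (i \<in> I)) mod m)"

definition vectors :: "(nat \<Rightarrow> nat) set" where
  "vectors = {v. (\<forall>i. v i < m) \<and> (\<exists>N. (\<forall>i\<ge>N. v i = 0) \<and> (\<Sum>i<N. v i) mod m = 1)}"

definition m_sets :: "nat set set" where
  "m_sets = {I. finite I \<and> card I = m}"

text \<open>Adding the indicator of a set with \<open>m\<close> elements preserves the sum modulo \<open>m\<close>; so the zero sequence of
  states, the pointwise limit of the unit sequences \<open>e i\<close>, is missing from this algebra.\<close>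

definition test_algebra :: "(nat \<Rightarrow> nat) binalg" where
  "test_algebra = \<lparr>universe = {\<lambda>_. 0} \<union> st ` vectors \<union> lt ` m_sets,
     mul = (\<lambda>x y i. act (x i) (y i))\<rparr>"

abbreviation T where "T \<equiv> universe test_algebra"

definition unit :: "nat \<Rightarrow> nat \<Rightarrow> nat" where
  "unit i = (\<lambda>j. of_bool (j = i))"

definition e :: "nat \<Rightarrow> nat \<Rightarrow> nat" where
  "e i = st (unit i)"

lemma m_gt_1: "1 < m"
  using modulus_ge_5[of n] by simp

lemma mul_test: "mul test_algebra x y = (\<lambda>i. act (x i) (y i))"
  by (simp add: test_algebra_def)

lemma st_lt: "mul test_algebra (st v) (lt I) = st (add_set v I)"
  by (simp add: mul_test st_def lt_def add_set_def act_def fun_eq_iff)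

lemma add_set_vectors:
  assumes v: "v \<in> vectors" and I: "I \<in> m_sets" shows "add_set v I \<in> vectors"
proof -
  obtain N where N: "\<forall>i\<ge>N. v i = 0" "(\<Sum>i<N. v i) mod m = 1" using v by (auto simp: vectors_def)
  obtain N' where N': "I \<subseteq> {..<N'}" using I by (auto simp: m_sets_def finite_nat_iff_bounded)
  define L where "L = max N N'"
  have I_L: "I \<subseteq> {..<L}" using N' by (auto simp: L_def)
  have "(\<Sum>i<L. v i) = (\<Sum>i<N. v i)"
    using N(1) by (intro sum.mono_neutral_right) (auto simp: L_def)
  moreover have "(\<Sum>i<L. of_bool (i \<in> I)) = card I"
    using I_L by (simp add: of_bool_def sum.If_cases Int_absorb1)
  ultimately have "(\<Sum>i<L. v i + of_bool (i \<in> I)) = (\<Sum>i<N. v i) + m"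
    using I by (simp add: sum.distrib m_sets_def)
  then have "(\<Sum>i<L. add_set v I i) mod m = 1"
    using N(2) by (simp add: add_set_def mod_sum_eq)
  moreover have "\<forall>i\<ge>L. add_set v I i = 0" using N(1) I_L by (auto simp: add_set_def L_def)
  moreover have "\<forall>i. add_set v I i < m" by (simp add: add_set_def)
  ultimately show ?thesis unfolding vectors_def by blast
qed

lemma unit_vectors: "unit i \<in> vectors"
proof -
  have "(\<Sum>j<Suc i. unit i j) = 1" by (simp add: unit_def of_bool_def)
  then have "(\<Sum>j<Suc i. unit i j) mod m = 1" using m_gt_1 by simp
  moreover have "\<forall>j\<ge>Suc i. unit i j = 0" "\<forall>j. unit i j < m" using m_gt_1 by (auto simp: unit_def)
  ultimately show ?thesis unfolding vectors_def by blast
qed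

lemma st_in_T [simp]: "v \<in> vectors \<Longrightarrow> st v \<in> T" and lt_in_T [simp]: "I \<in> m_sets \<Longrightarrow> lt I \<in> T"
  and zero_in_T: "(\<lambda>_. 0) \<in> T"
  by (simp_all add: test_algebra_def)

lemma e_in_T [simp]: "e i \<in> T"
  by (simp add: e_def unit_vectors)

lemma mul_in_T: assumes "x \<in> T" "y \<in> T" shows "mul test_algebra x y \<in> T"
proof (cases "x \<in> st ` vectors \<and> y \<in> lt ` m_sets")
  case True
  then show ?thesis using st_lt add_set_vectors st_in_T by auto
next
  case False
  then have "mul test_algebra x y = (\<lambda>_. 0)"
    using assms by (auto simp: test_algebra_def act_def st_def lt_def fun_eq_iff)
  then show ?thesis using zero_in_T by simp
qed

lemma binary_algebra_test: "binary_algebra test_algebra"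
  using mul_in_T zero_in_T by (auto simp: binary_algebra_def subuniverse_def)

lemma coordinate_hom: "(\<lambda>a\<in>T. a i) \<in> homs test_algebra M"
proof -
  have "a i \<in> universe M" if "a \<in> T" for a
    using that m_gt_1 by (auto simp: test_algebra_def st_def lt_def vectors_def of_bool_def)
  then show ?thesis using mul_in_T by (auto simp: homs_def mul_test)
qed

lemma in_ISP_test: "in_ISP M test_algebra"
proof (rule ISP_if_separating[OF binary_algebra_test])
  fix a b assume ab: "a \<in> T" "b \<in> T" "a \<noteq> b"
  then obtain i where "a i \<noteq> b i" by blast
  then show "\<exists>x\<in>homs test_algebra M. x a \<noteq> x b"
    using ab coordinate_hom by (intro bexI[of _ "\<lambda>a\<in>T. a i"]) auto
qed

lemma iterate_lt:
  assumes "\<And>i. v i < m"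
  shows "((\<lambda>u. mul test_algebra u (lt I)) ^^ k) (st v) = st (\<lambda>i. (v i + k * of_bool (i \<in> I)) mod m)"
proof (induction k)
  case 0 then show ?case using assms by simp
next
  case (Suc k)
  then show ?case by (simp add: st_lt add_set_def mod_simps algebra_simps)
qed

lemma iterate_lt_m:
  assumes "v \<in> vectors" shows "((\<lambda>u. mul test_algebra u (lt I)) ^^ m) (st v) = st v"
  using assms by (subst iterate_lt) (auto simp: vectors_def)

context
  fixes x assumes x: "x \<in> homs test_algebra M"
begin

lemma x_mul: "u \<in> T \<Longrightarrow> v \<in> T \<Longrightarrow> x (mul test_algebra u v) = act (x u) (x v)"
  using x by (simp add: homs_def)

lemma x_universe: "u \<in> T \<Longrightarrow> x u \<in> universe M"
  using x by (auto simp: homs_def)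

lemma iterate_in_T: "u \<in> T \<Longrightarrow> l \<in> T \<Longrightarrow> ((\<lambda>u. mul test_algebra u l) ^^ k) u \<in> T"
  by (induction k) (auto intro: mul_in_T)

text \<open>Used with \<open>m\<close> iterations, where the iterate is \<open>u\<close> itself.\<close>

lemma x_iterate:
  assumes u: "u \<in> T" "l \<in> T" and s: "is_state (x (((\<lambda>u. mul test_algebra u l) ^^ Suc k) u))"
  shows "is_state (x u) \<and> is_letter (x l) \<and> block (x l) = block (x u) \<and>
    block (x (((\<lambda>u. mul test_algebra u l) ^^ Suc k) u)) = block (x u) \<and>
    [val (x (((\<lambda>u. mul test_algebra u l) ^^ Suc k) u)) = val (x u) + Suc k * val (x l)] (mod modulus (block (x u)))"
  using s
proof (induction k)
  case 0
  then have "x (mul test_algebra u l) = act (x u) (x l)" using x_mul u by blast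
  then show ?case using 0 by (auto simp: block_act val_act)
next
  case (Suc k)
  let ?w = "((\<lambda>u. mul test_algebra u l) ^^ Suc k) u"
  have eq: "x (((\<lambda>u. mul test_algebra u l) ^^ Suc (Suc k)) u) = act (x ?w) (x l)"
    using x_mul[OF iterate_in_T[OF u, of "Suc k"] u(2)] by simp
  then have st: "is_state (act (x ?w) (x l))" using Suc.prems by simp
  then have IH: "is_state (x u) \<and> is_letter (x l) \<and> block (x l) = block (x u) \<and> block (x ?w) = block (x u) \<and>
    [val (x ?w) = val (x u) + Suc k * val (x l)] (mod modulus (block (x u)))"
    using Suc.IH is_state_act by blast
  have "[val (x ?w) + val (x l) = val (x u) + Suc k * val (x l) + val (x l)] (mod modulus (block (x u)))"
    using IH by (intro cong_add cong_refl) blast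
  then have "[val (act (x ?w) (x l)) = val (x u) + Suc (Suc k) * val (x l)] (mod modulus (block (x u)))"
    using IH val_act[OF st] by (simp add: algebra_simps)
  then show ?case unfolding eq using IH block_act[OF st] by simp
qed

lemma x_e_not_letter: "\<not> is_letter (x (e i))"
proof -
  obtain I :: "nat set" where "finite I" "card I = m" using infinite_arbitrarily_large[OF infinite_UNIV_nat] by metis
  then have I: "I \<in> m_sets" by (simp add: m_sets_def)
  obtain k where k: "m = Suc k" using m_gt_1 by (cases m) auto
  let ?w = "((\<lambda>u. mul test_algebra u (lt I)) ^^ k) (e i)"
  have "e i = mul test_algebra ?w (lt I)"
    using iterate_lt_m[OF unit_vectors, of I i] k by (simp add: e_def)
  then have "x (e i) = act (x ?w) (x (lt I))" using x_mul iterate_in_T e_in_T lt_in_T[OF I] by metis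
  then show ?thesis by simp
qed

text \<open>Multiplying \<open>m\<close> times with a letter returns to the start, so the letter is sent to a residue
  annihilated by \<open>m\<close>: in the blocks before \<open>n\<close> this must be \<open>0\<close>, as the moduli are coprime. In block
  \<open>n\<close> only \<open>0\<close> and \<open>1\<close> are letters.\<close>

lemma x_letters:
  assumes s: "is_state (x (e i))" and I: "I \<in> m_sets"
  shows "is_letter (x (lt I))" "block (x (lt I)) = block (x (e i))" "val (x (lt I)) < 2"
proof -
  obtain k where k: "m = Suc k" using m_gt_1 by (cases m) auto
  have "((\<lambda>u. mul test_algebra u (lt I)) ^^ Suc k) (e i) = e i"
    using iterate_lt_m[OF unit_vectors, of I i] k by (simp add: e_def)
  then have *: "is_letter (x (lt I))" "block (x (lt I)) = block (x (e i))"
    "[val (x (e i)) = val (x (e i)) + m * val (x (lt I))] (mod modulus (block (x (e i))))"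
    using x_iterate[OF e_in_T lt_in_T[OF I], of k i] s k by auto
  then show "is_letter (x (lt I))" "block (x (lt I)) = block (x (e i))" by auto
  show "val (x (lt I)) < 2"
  proof (cases "block (x (lt I)) = n")
    case True
    then show ?thesis using x_universe[OF lt_in_T[OF I]] *(1) nonzero by (auto simp: universe_iff)
  next
    case False
    let ?p = "modulus (block (x (lt I)))"
    have "[m * val (x (lt I)) = 0] (mod ?p)"
      using *(2,3) by (metis cong_add_lcancel_0_nat cong_sym)
    then have "?p dvd m * val (x (lt I))" by (simp add: cong_0_iff)
    then have "?p dvd val (x (lt I))" using coprime_modulus[OF False] coprime_dvd_mult_right_iff by blast
    moreover have "val (x (lt I)) < ?p"
      using x_universe[OF lt_in_T[OF I]] *(1) nonzero by (auto simp: universe_iff)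
    ultimately show ?thesis using nat_dvd_not_less by fastforce
  qed
qed

lemma exchange:
  assumes "i \<notin> K" "j \<notin> K" "i \<noteq> j"
  shows "mul test_algebra (e i) (lt (insert j K)) = mul test_algebra (e j) (lt (insert i K))"
  unfolding e_def st_lt using assms by (auto simp: st_def add_set_def unit_def fun_eq_iff)

lemma insert_m_sets: "finite K \<Longrightarrow> i \<notin> K \<Longrightarrow> card K = m - 1 \<Longrightarrow> insert i K \<in> m_sets"
  using m_gt_1 by (auto simp: m_sets_def)

lemma x_exchange:
  assumes s: "is_state (x (e i))" and K: "finite K" "card K = m - 1" "i \<notin> K" "j \<notin> K" "i \<noteq> j"
  shows "is_state (x (e j))" "block (x (e j)) = block (x (e i))"
    "[val (x (e i)) + val (x (lt (insert j K))) = val (x (e j)) + val (x (lt (insert i K)))]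
      (mod modulus (block (x (e i))))"
proof -
  have I: "insert i K \<in> m_sets" "insert j K \<in> m_sets" using insert_m_sets K by auto
  have eq: "act (x (e i)) (x (lt (insert j K))) = act (x (e j)) (x (lt (insert i K)))"
    using exchange[OF K(3-5)] x_mul I by (metis e_in_T lt_in_T)
  have l: "is_state (act (x (e i)) (x (lt (insert j K))))" using x_letters[OF s I(2)] s by simp
  then have r: "is_state (act (x (e j)) (x (lt (insert i K))))" using eq by simp
  then show sj: "is_state (x (e j))" "block (x (e j)) = block (x (e i))"
    using x_letters[OF s I(1)] by auto
  show "[val (x (e i)) + val (x (lt (insert j K))) = val (x (e j)) + val (x (lt (insert i K)))]
      (mod modulus (block (x (e i))))"
    using val_act[OF l] val_act[OF r] eq sj(2) by (simp add: cong_def)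
qed

text \<open>With values in one block, let \<open>\<theta> i\<close> be the residue at \<open>e i\<close> and \<open>\<mu> I\<close> in \<open>{0, 1}\<close> the one at the
  letter \<open>I\<close>. Exchanging \<open>i\<close> and \<open>j\<close> in a set shows that \<open>\<theta> i - \<theta> j\<close> is a difference of two values of
  \<open>\<mu>\<close>, and exchanging two pairs shows the same for \<open>(\<theta> i - \<theta> j) + (\<theta> k - \<theta> l)\<close>. Both differences
  being nonzero is impossible by \<open>signs_conflict\<close>, applied to the pairs with both orders of \<open>k\<close> and \<open>l\<close>.\<close>

lemma x_e_one_exception: "\<exists>s j. \<forall>i. i \<noteq> j \<longrightarrow> x (e i) = s"
proof (cases "\<exists>i. is_state (x (e i))")
  case False
  then have "x (e i) = 0" for i using x_e_not_letter state_or_letter(1) by blast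
  then show ?thesis by blast
next
  case True
  then obtain i0 where i0: "is_state (x (e i0))" by blast
  define b where "b = block (x (e i0))"
  define p where "p = int (modulus b)"
  have p: "5 \<le> p" using modulus_ge_5[of b] by (simp add: p_def)
  have fresh: "\<exists>K :: nat set. finite K \<and> card K = k \<and> K \<inter> S = {}" if "finite S" for S k
  proof -
    have "infinite (- S)" using that by (simp add: Compl_eq_Diff_UNIV)
    then show ?thesis using infinite_arbitrarily_large[of "- S" k] by blast
  qed
  have state: "is_state (x (e j)) \<and> block (x (e j)) = b" for j
  proof (cases "j = i0")
    case True then show ?thesis using i0 b_def by simp
  next
    case False
    obtain K where "finite K" "card K = m - 1" "K \<inter> {i0, j} = {}" using fresh[of "{i0, j}" "m - 1"] by auto
    then show ?thesis using x_exchange(1,2)[OF i0, of K j] False b_def by auto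
  qed
  define \<theta> where "\<theta> = (\<lambda>i. int (val (x (e i))))"
  define \<mu> where "\<mu> = (\<lambda>I. int (val (x (lt I))))"
  have \<mu>: "0 \<le> \<mu> I \<and> \<mu> I \<le> 1" if "I \<in> m_sets" for I
    using x_letters(3)[OF i0 that] by (simp add: \<mu>_def)
  have ex: "p dvd (\<theta> i - \<theta> j) - (\<mu> (insert i K) - \<mu> (insert j K))"
    if "finite K" "card K = m - 1" "i \<notin> K" "j \<notin> K" "i \<noteq> j" for i j K
  proof -
    have "[val (x (e i)) + val (x (lt (insert j K))) = val (x (e j)) + val (x (lt (insert i K)))] (mod modulus b)"
      using x_exchange(3)[of i K j] state that by simp
    then have "[\<theta> i + \<mu> (insert j K) = \<theta> j + \<mu> (insert i K)] (mod p)"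
      unfolding \<theta>_def \<mu>_def p_def by (metis cong_int_iff of_nat_add)
    then show ?thesis by (simp add: cong_iff_dvd_diff algebra_simps)
  qed
  have one: "\<exists>a. \<bar>a\<bar> \<le> 1 \<and> p dvd (\<theta> i - \<theta> j) - a" if "i \<noteq> j" for i j
  proof -
    obtain K where K: "finite K" "card K = m - 1" "K \<inter> {i, j} = {}" using fresh[of "{i, j}" "m - 1"] by auto
    then have "insert i K \<in> m_sets" "insert j K \<in> m_sets" using insert_m_sets by auto
    from \<mu>[OF this(1)] \<mu>[OF this(2)] have "\<bar>\<mu> (insert i K) - \<mu> (insert j K)\<bar> \<le> 1" by linarith
    then show ?thesis using ex[of K i j] K that by auto
  qed
  have two: "\<exists>a. \<bar>a\<bar> \<le> 1 \<and> p dvd (\<theta> i - \<theta> j) + (\<theta> k - \<theta> l) - a" if d: "distinct [i, j, k, l]" for i j k l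
  proof -
    obtain R where R: "finite R" "card R = m - 2" "R \<inter> {i, j, k, l} = {}"
      using fresh[of "{i, j, k, l}" "m - 2"] by auto
    have c: "card (insert k R) = m - 1" "card (insert j R) = m - 1" using R m_gt_1 by auto
    \<comment> \<open>Exchange \<open>i\<close> for \<open>j\<close> next to \<open>k\<close>, then \<open>k\<close> for \<open>l\<close> next to \<open>j\<close>; the middle term cancels.\<close>
    have sw: "insert k (insert j R) = insert j (insert k R)" by auto
    have "p dvd (\<theta> i - \<theta> j) - (\<mu> (insert i (insert k R)) - \<mu> (insert j (insert k R)))"
      using R d c by (intro ex) auto
    moreover have "p dvd (\<theta> k - \<theta> l) - (\<mu> (insert k (insert j R)) - \<mu> (insert l (insert j R)))"
      using R d c by (intro ex) auto
    ultimately have "p dvd ((\<theta> i - \<theta> j) - (\<mu> (insert i (insert k R)) - \<mu> (insert j (insert k R))))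
        + ((\<theta> k - \<theta> l) - (\<mu> (insert k (insert j R)) - \<mu> (insert l (insert j R))))" by (rule dvd_add)
    then have "p dvd (\<theta> i - \<theta> j) + (\<theta> k - \<theta> l) - (\<mu> (insert i (insert k R)) - \<mu> (insert l (insert j R)))"
      unfolding sw by (simp add: algebra_simps)
    moreover have I: "insert i (insert k R) \<in> m_sets" "insert l (insert j R) \<in> m_sets"
      using R d c by (auto intro!: insert_m_sets)
    from \<mu>[OF I(1)] \<mu>[OF I(2)]
    have "\<bar>\<mu> (insert i (insert k R)) - \<mu> (insert l (insert j R))\<bar> \<le> 1" by linarith
    ultimately show ?thesis by blast
  qed
  have lt: "0 \<le> \<theta> i \<and> \<theta> i < p" for i
    using x_universe[OF e_in_T, of i] state[of i] nonzero by (auto simp: universe_iff \<theta>_def p_def)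
  have eq: "x (e i) = x (e j)" if "p dvd \<theta> i - \<theta> j" for i j
  proof -
    have "\<bar>\<theta> i - \<theta> j\<bar> < p" using lt[of i] lt[of j] by auto
    then have "\<theta> i - \<theta> j = 0" using small_multiple that by blast
    then have "val (x (e i)) = val (x (e j))" by (simp add: \<theta>_def)
    then show ?thesis using state[of i] state[of j] state_block_val by metis
  qed
  show ?thesis
  proof (rule one_exception)
    fix i j k l :: nat assume d: "distinct [i, j, k, l]"
    obtain a1 a2 where "\<bar>a1\<bar> \<le> 1" "p dvd (\<theta> i - \<theta> j) - a1" "\<bar>a2\<bar> \<le> 1" "p dvd (\<theta> k - \<theta> l) - a2"
      using one d by (metis distinct_length_2_or_more)
    moreover obtain a3 where "\<bar>a3\<bar> \<le> 1" "p dvd (\<theta> i - \<theta> j) + (\<theta> k - \<theta> l) - a3" using two[OF d] by blast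
    moreover obtain a4 where "\<bar>a4\<bar> \<le> 1" "p dvd (\<theta> i - \<theta> j) + (\<theta> l - \<theta> k) - a4"
      using two[of i j l k] d by auto
    then have "p dvd (\<theta> i - \<theta> j) - (\<theta> k - \<theta> l) - a4" by (simp add: algebra_simps)
    ultimately have "p dvd \<theta> i - \<theta> j \<or> p dvd \<theta> k - \<theta> l"
      using signs_conflict[OF p] \<open>\<bar>a4\<bar> \<le> 1\<close> by blast
    then show "x (e i) = x (e j) \<or> x (e k) = x (e l)" using eq by blast
  qed
qed

end

text \<open>With at most one exception among the \<open>e i\<close>, three of them determine the value on almost all. This makes
  the map continuous.\<close>

definition majority :: "((nat \<Rightarrow> nat) \<Rightarrow> nat) \<Rightarrow> nat" where
  "majority x = (if x (e 0) = x (e 1) then x (e 0) else x (e 2))"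

lemma majority_eq:
  assumes "x \<in> homs test_algebra M" shows "\<exists>j. \<forall>i. i \<noteq> j \<longrightarrow> majority x = x (e i)"
proof -
  obtain s j where sj: "\<And>i. i \<noteq> j \<Longrightarrow> x (e i) = s" using x_e_one_exception[OF assms] by blast
  then have "majority x = s" using sj[of 0] sj[of 1] sj[of 2]
    by (cases "j = 0"; cases "j = 1"; simp add: majority_def del: One_nat_def)
  then show ?thesis using sj by metis
qed

lemma majority_continuous: "continuous_map (hom_space test_algebra M) (discrete_topology (universe M)) majority"
  unfolding continuous_map_def
proof (intro conjI allI impI)
  have top: "topspace (hom_space test_algebra M) = homs test_algebra M"
    by (auto simp: hom_space_def homs_def)
  have "majority x \<in> universe M" if "x \<in> homs test_algebra M" for x
    using that x_universe[OF that] e_in_T by (simp add: majority_def)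
  then show "majority \<in> topspace (hom_space test_algebra M) \<rightarrow> topspace (discrete_topology (universe M))"
    by (simp add: top)
  fix W
  have "openin (product_topology (\<lambda>_. discrete_topology (universe M)) T)
      {x \<in> T \<rightarrow>\<^sub>E universe M. majority x \<in> W}"
    by (rule openin_finite_coordinates[of "{e 0, e 1, e 2}"]) (auto simp: majority_def)
  moreover have "{x \<in> topspace (hom_space test_algebra M). majority x \<in> W} =
      {x \<in> T \<rightarrow>\<^sub>E universe M. majority x \<in> W} \<inter> homs test_algebra M"
    unfolding top by (auto simp: homs_def)
  ultimately show "openin (hom_space test_algebra M)
      {x \<in> topspace (hom_space test_algebra M). majority x \<in> W}"
    unfolding hom_space_def openin_subtopology by blast
qed

text \<open>Finitely many homomorphisms have finitely many exceptions, so there is some \<open>e l\<close> at which \<open>majority\<close>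
  is the evaluation for all of them.\<close>

lemma majority_preserves: "preserves test_algebra M majority k r"
  unfolding preserves_def
proof (intro allI impI, elim conjE)
  fix x assume x: "\<forall>i<k. x i \<in> homs test_algebra M" "\<forall>a\<in>T. (\<lambda>i\<in>{..<k}. x i a) \<in> r"
  have "\<forall>i. \<exists>j. i < k \<longrightarrow> (\<forall>l. l \<noteq> j \<longrightarrow> majority (x i) = x i (e l))"
    using majority_eq x(1) by blast
  then obtain j where j: "\<And>i l. i < k \<Longrightarrow> l \<noteq> j i \<Longrightarrow> majority (x i) = x i (e l)" by metis
  obtain l where "l \<notin> j ` {..<k}" using ex_new_if_finite[of "j ` {..<k}"] by auto
  then have "(\<lambda>i\<in>{..<k}. majority (x i)) = (\<lambda>i\<in>{..<k}. x i (e l))"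
    using j by (intro restrict_ext) auto
  then show "(\<lambda>i\<in>{..<k}. majority (x i)) \<in> r" using x(2) e_in_T by metis
qed

lemma majority_not_evaluation: "\<not> evaluation test_algebra M majority"
proof
  assume "evaluation test_algebra M majority"
  then obtain a where a: "a \<in> T" "\<And>x. x \<in> homs test_algebra M \<Longrightarrow> majority x = x a"
    by (auto simp: evaluation_def)
  have ai: "a i = state n 0" for i
  proof -
    have "majority (\<lambda>a\<in>T. a i) = state n 0"
      by (auto simp: majority_def) (auto simp: e_def st_def unit_def)
    then show ?thesis using a(2)[OF coordinate_hom[of i]] a(1) by simp
  qed
  then have "a \<noteq> (\<lambda>_. 0)" "a \<noteq> lt I" for I
    using is_state_state(1)[of n 0] by (metis not_zero(1), metis lt_def is_letter_letter(2))
  then obtain v where v: "v \<in> vectors" "a = st v" using a(1) by (auto simp: test_algebra_def)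
  then have "v i = 0" for i using ai[of i] block_val(2) by (metis st_def)
  then show False using v(1) by (auto simp: vectors_def)
qed

lemma not_dualizable_two_letters: "\<not> dualizable TYPE('c::infinite) M"
proof
  assume "dualizable TYPE('c) M"
  then have "dualizable TYPE(nat \<Rightarrow> nat) M"
    by (rule dualizable_any_type[OF binary_algebra_cyclic_blocks finite_cyclic_blocks])
  then show False
    using in_ISP_test majority_continuous majority_preserves majority_not_evaluation
    unfolding dualizable_def by blast
qed

end

section \<open>The alternating chain\<close>

theorem mainTheorem10:
  shows "\<exists>M :: nat \<Rightarrow> nat binalg.
    (\<forall>n\<ge>1. finite (universe (M n)) \<and> automatic_algebra (M n)) \<and>
    (\<forall>n\<ge>1. is_subalgebra (M n) (M (n + 1))) \<and>
    (\<forall>n\<ge>1. dualizable TYPE('b::infinite) (M n) \<longleftrightarrow> \<not> dualizable TYPE('b) (M (n + 1)))"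
proof -
  define M where "M = (\<lambda>n. cyclic_blocks ((n + 1) div 2) (n div 2 + 1))"
  have sub: "is_subalgebra (M n) (M (n + 1))" for n
  proof -
    have "subuniverse (universe (M n)) (M (n + 1))"
      unfolding M_def by (intro subuniverse_cyclic_blocks add_mono div_le_mono) auto
    moreover have "universe (M n) \<noteq> {}" unfolding M_def using zero_in_universe by (metis empty_iff)
    ultimately show ?thesis by (simp add: is_subalgebra_def M_def)
  qed
  have dual: "dualizable TYPE('b) (M n) \<longleftrightarrow> odd n" for n
  proof (cases "odd n")
    case True
    then have "(n + 1) div 2 = n div 2 + 1" by presburger
    then show ?thesis using True dualizable_complete_blocks by (simp add: M_def)
  next
    case False
    then have "(n + 1) div 2 = n div 2" by presburger
    then show ?thesis using False two_letter_block.not_dualizable_two_letters by (simp add: M_def)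
  qed
  have "finite (universe (M n)) \<and> automatic_algebra (M n)" for n
    by (simp add: M_def finite_cyclic_blocks automatic_cyclic_blocks)
  moreover have "dualizable TYPE('b) (M n) \<longleftrightarrow> \<not> dualizable TYPE('b) (M (n + 1))" for n
    unfolding dual by simp
  ultimately show ?thesis using sub by (intro exI[of _ M]) blast
qed

end
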